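(* Let $R$ be a semiring, $M$ a bipotent semiring, and let $v:R\to M$ be a surjective $V^0$-valuation or a surjective $V$-valuation. Let $C=C(M)$ be the minimal cancellative relation on $M$, let $\overline M:=M/C$, and let $v/C:=\pi_C\circ v:R\to\overline M$. Then $v$ has UIC, hence also $v/C$ has UIC. If moreover $\{x\in\overline M\mid x<1\}\neq\{0\}$, then $v/C$ is again a $V^0$-valuation or a $V$-valuation (not necessarily of the same type as $v$).
   Context: All semirings are commutative with $0$ and $1$. A bipotent semiring is a semiring $M$ equipped with a total ordering such that $(M,\cdot)$ is a totally ordered monoid (the order is compatible with multiplication), $0$ is the smallest element (and is absorbing), and $x+y=\max(x,y)$. An $m$-valuation is a map $v:R\to M$ to a bipotent semiring with $v(0)=0$, $v(1)=1$, $v(xy)=v(x)v(y)$, $v(x+y)\le\max(v(x),v(y))$. Two $m$-valuations $v,w$ on $R$ are equivalent if $v(a)\le v(b)\iff w(a)\le w(b)$ for all $a,b\in R$. An $m$-valuation $v:R\to M$ has UIC (unit incapsulation) if for any $x,y\in R$ with $v(x)<v(y)$ there is $z\in R$ with $v(xz)\le1\le v(yz)$. For $L\subset R$ and $x\in R$ put $[L:x]=\{z\in R\mid zx\in L\}$. A prime of $R$ is a subset $\mathfrak p$ with $0\in\mathfrak p$, $1\notin\mathfrak p$, $\mathfrak p+\mathfrak p\subset\mathfrak p$, and both $\mathfrak p$ and $R\setminus\mathfrak p$ closed under multiplication. A proper CMC-subsemiring of $R$ is a subsemiring $A\ne R$ (with $0,1\in A$) such that $R\setminus A$ is closed under multiplication.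 For $L$ a prime or a proper CMC-subsemiring, let $x\sim y$ iff $[L:x]=[L:y]$. Then $M(R,L):=R/\!\sim$, with $[x][y]=[xy]$, the total ordering $[y]\le[x]\iff[L:x]\subset[L:y]$, and addition given by the maximum, is a bipotent semiring, and $v_{R,L}:R\to M(R,L)$, $x\mapsto[x]$, is an $m$-valuation. A $V^0$-valuation is an $m$-valuation equivalent to $v_{R,\mathfrak p}$ for some prime $\mathfrak p$ of $R$. A $V$-valuation is an $m$-valuation equivalent to $v_{R,A}$ for some proper CMC-subsemiring $A$ of $R$. The minimal cancellative relation $C(M)$ on a nonzero bipotent semiring $M$: with $\mathfrak q=\{x\in M\mid\exists n: x^n=0\}$, $x\sim_C y$ iff either $x,y\in\mathfrak q$ or there is $s\in M\setminus\mathfrak q$ with $sx=sy$. It is a congruence of the semiring $M$, $M/C$ is a cancellative bipotent semiring, and $\pi_C:M\to M/C$ is the quotient homomorphism. *)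

theory Defs
  imports "HOL-Algebra.Ring"
begin

section \<open>Commutative semirings and bipotent semirings\<close>

text \<open>
  The zero semiring (with \<open>\<one> = \<zero>\<close>) is not excluded.
\<close>

locale csemiring = semiring R + comm_monoid R for R (structure)

record 'a osemiring = "'a ring" +
  leq :: "['a, 'a] \<Rightarrow> bool" (infixl \<open>\<preceq>\<index>\<close> 50)

definition lt :: "('a, 'b) osemiring_scheme \<Rightarrow> 'a \<Rightarrow> 'a \<Rightarrow> bool" (infixl \<open>\<prec>\<index>\<close> 50)
  where "x \<prec>\<^bsub>M\<^esub> y \<longleftrightarrow> x \<preceq>\<^bsub>M\<^esub> y \<and> x \<noteq> y"

definition omax :: "('a, 'b) osemiring_scheme \<Rightarrow> 'a \<Rightarrow> 'a \<Rightarrow> 'a"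
  where "omax M x y = (if x \<preceq>\<^bsub>M\<^esub> y then y else x)"

locale bipotent_semiring = csemiring M for M (structure) +
  assumes leq_refl: "x \<in> carrier M \<Longrightarrow> x \<preceq> x"
    and leq_antisym: "\<lbrakk>x \<preceq> y; y \<preceq> x; x \<in> carrier M; y \<in> carrier M\<rbrakk> \<Longrightarrow> x = y"
    and leq_trans: "\<lbrakk>x \<preceq> y; y \<preceq> z; x \<in> carrier M; y \<in> carrier M; z \<in> carrier M\<rbrakk> \<Longrightarrow> x \<preceq> z"
    and leq_total: "\<lbrakk>x \<in> carrier M; y \<in> carrier M\<rbrakk> \<Longrightarrow> x \<preceq> y \<or> y \<preceq> x"
    and mult_mono: "\<lbrakk>x \<preceq> y; x \<in> carrier M; y \<in> carrier M; z \<in> carrier M\<rbrakk> \<Longrightarrow> x \<otimes> z \<preceq> y \<otimes> z"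
    and zero_least: "x \<in> carrier M \<Longrightarrow> \<zero> \<preceq> x"
    and add_eq_max: "\<lbrakk>x \<in> carrier M; y \<in> carrier M\<rbrakk> \<Longrightarrow> x \<oplus> y = omax M x y"

section \<open>m-valuations\<close>

locale m_valuation = R: csemiring R + M: bipotent_semiring M
  for R (structure) and M (structure) and v +
  assumes v_closed: "v \<in> carrier R \<rightarrow> carrier M"
    and v_zero: "v \<zero>\<^bsub>R\<^esub> = \<zero>\<^bsub>M\<^esub>"
    and v_one: "v \<one>\<^bsub>R\<^esub> = \<one>\<^bsub>M\<^esub>"
    and v_mult: "\<lbrakk>x \<in> carrier R; y \<in> carrier R\<rbrakk> \<Longrightarrow> v (x \<otimes>\<^bsub>R\<^esub> y) = v x \<otimes>\<^bsub>M\<^esub> v y"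
    and v_add: "\<lbrakk>x \<in> carrier R; y \<in> carrier R\<rbrakk> \<Longrightarrow> v (x \<oplus>\<^bsub>R\<^esub> y) \<preceq>\<^bsub>M\<^esub> omax M (v x) (v y)"

definition equivalent_valuations ::
  "('r, 'a) ring_scheme \<Rightarrow> ('m, 'b) osemiring_scheme \<Rightarrow> ('r \<Rightarrow> 'm)
    \<Rightarrow> ('n, 'c) osemiring_scheme \<Rightarrow> ('r \<Rightarrow> 'n) \<Rightarrow> bool"
  where "equivalent_valuations R M v N w \<longleftrightarrow>
    (\<forall>a\<in>carrier R. \<forall>b\<in>carrier R. v a \<preceq>\<^bsub>M\<^esub> v b \<longleftrightarrow> w a \<preceq>\<^bsub>N\<^esub> w b)"

definition UIC :: "('r, 'a) ring_scheme \<Rightarrow> ('m, 'b) osemiring_scheme \<Rightarrow> ('r \<Rightarrow> 'm) \<Rightarrow> bool"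
  where "UIC R M v \<longleftrightarrow>
    (\<forall>x\<in>carrier R. \<forall>y\<in>carrier R. v x \<prec>\<^bsub>M\<^esub> v y \<longrightarrow>
      (\<exists>z\<in>carrier R. v (x \<otimes>\<^bsub>R\<^esub> z) \<preceq>\<^bsub>M\<^esub> \<one>\<^bsub>M\<^esub> \<and> \<one>\<^bsub>M\<^esub> \<preceq>\<^bsub>M\<^esub> v (y \<otimes>\<^bsub>R\<^esub> z)))"

section \<open>Primes, CMC-subsemirings and the associated m-valuations\<close>

definition mult_closed :: "('r, 'a) ring_scheme \<Rightarrow> 'r set \<Rightarrow> bool"
  where "mult_closed R S \<longleftrightarrow> (\<forall>x\<in>S. \<forall>y\<in>S. x \<otimes>\<^bsub>R\<^esub> y \<in> S)"

definition add_closed :: "('r, 'a) ring_scheme \<Rightarrow> 'r set \<Rightarrow> bool"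
  where "add_closed R S \<longleftrightarrow> (\<forall>x\<in>S. \<forall>y\<in>S. x \<oplus>\<^bsub>R\<^esub> y \<in> S)"

definition semiring_prime :: "('r, 'a) ring_scheme \<Rightarrow> 'r set \<Rightarrow> bool"
  where "semiring_prime R p \<longleftrightarrow>
    p \<subseteq> carrier R \<and> \<zero>\<^bsub>R\<^esub> \<in> p \<and> \<one>\<^bsub>R\<^esub> \<notin> p \<and> add_closed R p \<and>
    mult_closed R p \<and> mult_closed R (carrier R - p)"

definition proper_CMC_subsemiring :: "('r, 'a) ring_scheme \<Rightarrow> 'r set \<Rightarrow> bool"
  where "proper_CMC_subsemiring R A \<longleftrightarrow>
    A \<subseteq> carrier R \<and> A \<noteq> carrier R \<and> \<zero>\<^bsub>R\<^esub> \<in> A \<and> \<one>\<^bsub>R\<^esub> \<in> A \<and> add_closed R A \<and>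
    mult_closed R A \<and> mult_closed R (carrier R - A)"

text \<open>\<open>residual R L x\<close> is $[L:x]$.\<close>

definition residual :: "('r, 'a) ring_scheme \<Rightarrow> 'r set \<Rightarrow> 'r \<Rightarrow> 'r set"
  where "residual R L x = {z \<in> carrier R. z \<otimes>\<^bsub>R\<^esub> x \<in> L}"

definition residual_rel :: "('r, 'a) ring_scheme \<Rightarrow> 'r set \<Rightarrow> ('r \<times> 'r) set"
  where "residual_rel R L =
    {(x, y). x \<in> carrier R \<and> y \<in> carrier R \<and> residual R L x = residual R L y}"

definition class_mult :: "('r, 'a) ring_scheme \<Rightarrow> ('r \<times> 'r) set \<Rightarrow> 'r set \<Rightarrow> 'r set \<Rightarrow> 'r set"
  where "class_mult R E X Y = (\<Union>x\<in>X. \<Union>y\<in>Y. E `` {x \<otimes>\<^bsub>R\<^esub> y})"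

definition class_add :: "('r, 'a) ring_scheme \<Rightarrow> ('r \<times> 'r) set \<Rightarrow> 'r set \<Rightarrow> 'r set \<Rightarrow> 'r set"
  where "class_add R E X Y = (\<Union>x\<in>X. \<Union>y\<in>Y. E `` {x \<oplus>\<^bsub>R\<^esub> y})"

definition residual_leq :: "('r, 'a) ring_scheme \<Rightarrow> 'r set \<Rightarrow> 'r set \<Rightarrow> 'r set \<Rightarrow> bool"
  where "residual_leq R L Y X \<longleftrightarrow> (\<exists>y\<in>Y. \<exists>x\<in>X. residual R L x \<subseteq> residual R L y)"

text \<open>
  \<open>M_of R L\<close> is $M(R,L)$ and \<open>v_of R L\<close> is $v_{R,L}$. Addition in \<open>M_of R L\<close> is the maximum, not
  the addition induced from \<open>R\<close> (for which the relation need not be a congruence).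
\<close>

definition M_of :: "('r, 'a) ring_scheme \<Rightarrow> 'r set \<Rightarrow> 'r set osemiring"
  where "M_of R L =
    \<lparr>carrier = carrier R // residual_rel R L,
     mult = class_mult R (residual_rel R L),
     one = residual_rel R L `` {\<one>\<^bsub>R\<^esub>},
     zero = residual_rel R L `` {\<zero>\<^bsub>R\<^esub>},
     add = (\<lambda>X Y. if residual_leq R L X Y then Y else X),
     leq = residual_leq R L\<rparr>"

definition v_of :: "('r, 'a) ring_scheme \<Rightarrow> 'r set \<Rightarrow> 'r \<Rightarrow> 'r set"
  where "v_of R L x = residual_rel R L `` {x}"

definition V0_valuation :: "('r, 'a) ring_scheme \<Rightarrow> ('m, 'b) osemiring_scheme \<Rightarrow> ('r \<Rightarrow> 'm) \<Rightarrow> bool"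
  where "V0_valuation R M v \<longleftrightarrow> m_valuation R M v \<and>
    (\<exists>p. semiring_prime R p \<and> equivalent_valuations R M v (M_of R p) (v_of R p))"

definition V_valuation :: "('r, 'a) ring_scheme \<Rightarrow> ('m, 'b) osemiring_scheme \<Rightarrow> ('r \<Rightarrow> 'm) \<Rightarrow> bool"
  where "V_valuation R M v \<longleftrightarrow> m_valuation R M v \<and>
    (\<exists>A. proper_CMC_subsemiring R A \<and> equivalent_valuations R M v (M_of R A) (v_of R A))"

section \<open>The minimal cancellative relation\<close>

definition nil_elements :: "('m, 'b) osemiring_scheme \<Rightarrow> 'm set"
  where "nil_elements M = {x \<in> carrier M. \<exists>n::nat. x [^]\<^bsub>M\<^esub> n = \<zero>\<^bsub>M\<^esub>}"

definition min_cancel_rel :: "('m, 'b) osemiring_scheme \<Rightarrow> ('m \<times> 'm) set"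
  where "min_cancel_rel M = {(x, y). x \<in> carrier M \<and> y \<in> carrier M \<and>
    (x \<in> nil_elements M \<and> y \<in> nil_elements M \<or>
     (\<exists>s \<in> carrier M - nil_elements M. s \<otimes>\<^bsub>M\<^esub> x = s \<otimes>\<^bsub>M\<^esub> y))}"

text \<open>
  The semiring structure of $M/E$ is induced from \<open>M\<close>, and so is its ordering, which is the
  one satisfying $[x] \le [y]$ whenever $x \le y$.
\<close>

definition quotient_semiring ::
  "('m, 'b) osemiring_scheme \<Rightarrow> ('m \<times> 'm) set \<Rightarrow> 'm set osemiring"
  where "quotient_semiring M E =
    \<lparr>carrier = carrier M // E,
     mult = class_mult M E,
     one = E `` {\<one>\<^bsub>M\<^esub>},
     zero = E `` {\<zero>\<^bsub>M\<^esub>},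
     add = class_add M E,
     leq = (\<lambda>X Y. \<exists>x\<in>X. \<exists>y\<in>Y. x \<preceq>\<^bsub>M\<^esub> y)\<rparr>"

definition quotient_map :: "('m \<times> 'm) set \<Rightarrow> 'm \<Rightarrow> 'm set"
  where "quotient_map E x = E `` {x}"

section \<open>Well-definedness of the constructions\<close>

lemma bipotent_semiringI:
  fixes M (structure)
  assumes M: "comm_monoid M" and z: "\<zero> \<in> carrier M"
    and refl: "\<And>x. x \<in> carrier M \<Longrightarrow> x \<preceq> x"
    and antisym: "\<And>x y. \<lbrakk>x \<preceq> y; y \<preceq> x; x \<in> carrier M; y \<in> carrier M\<rbrakk> \<Longrightarrow> x = y"
    and trans: "\<And>x y z. \<lbrakk>x \<preceq> y; y \<preceq> z; x \<in> carrier M; y \<in> carrier M; z \<in> carrier M\<rbrakk> \<Longrightarrow> x \<preceq> z"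
    and total: "\<And>x y. \<lbrakk>x \<in> carrier M; y \<in> carrier M\<rbrakk> \<Longrightarrow> x \<preceq> y \<or> y \<preceq> x"
    and mono: "\<And>x y z. \<lbrakk>x \<preceq> y; x \<in> carrier M; y \<in> carrier M; z \<in> carrier M\<rbrakk> \<Longrightarrow> x \<otimes> z \<preceq> y \<otimes> z"
    and least: "\<And>x. x \<in> carrier M \<Longrightarrow> \<zero> \<preceq> x"
    and absorb: "\<And>x. x \<in> carrier M \<Longrightarrow> \<zero> \<otimes> x = \<zero>"
    and add: "\<And>x y. \<lbrakk>x \<in> carrier M; y \<in> carrier M\<rbrakk> \<Longrightarrow> x \<oplus> y = omax M x y"
  shows "bipotent_semiring M"
proof -
  interpret comm_monoid M by (rule M)
  have cl: "x \<oplus> y \<in> carrier M" if "x \<in> carrier M" "y \<in> carrier M" for x y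
    using that by (simp add: add omax_def)
  have comm: "x \<oplus> y = y \<oplus> x" if "x \<in> carrier M" "y \<in> carrier M" for x y
    using that antisym[of x y] total[of x y] by (auto simp: add omax_def)
  have ab: "abelian_monoid M"
  proof (rule abelian_monoidI)
    fix x y w assume c: "x \<in> carrier M" "y \<in> carrier M" "w \<in> carrier M"
    have 1: "x \<preceq> w" if "x \<preceq> y" "y \<preceq> w" using that c trans by blast
    have 2: "\<not> x \<preceq> w" if "\<not> x \<preceq> y" "\<not> y \<preceq> w"
      using that c total[of w y] total[of x y] trans[of x w y] by blast
    show "x \<oplus> y \<oplus> w = x \<oplus> (y \<oplus> w)"
      using c 1 2 by (cases "x \<preceq> y"; cases "y \<preceq> w"; cases "x \<preceq> w") (simp_all add: add omax_def)
  next
    fix x assume "x \<in> carrier M"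
    then show "\<zero> \<oplus> x = x" using z least by (simp add: add omax_def)
  qed (simp_all add: z cl comm)
  interpret abelian_monoid M by (rule ab)
  have ldist: "(x \<oplus> y) \<otimes> w = x \<otimes> w \<oplus> y \<otimes> w"
    if "x \<in> carrier M" "y \<in> carrier M" "w \<in> carrier M" for x y w
    using that total[of x y] mono[of x y w] mono[of y x w] antisym[of "x \<otimes> w" "y \<otimes> w"]
    by (auto simp: add omax_def)
  show ?thesis
  proof unfold_locales
    fix x y w assume c: "x \<in> carrier M" "y \<in> carrier M" "w \<in> carrier M"
    show "(x \<oplus> y) \<otimes> w = x \<otimes> w \<oplus> y \<otimes> w" using c by (rule ldist)
    show "w \<otimes> (x \<oplus> y) = w \<otimes> x \<oplus> w \<otimes> y"
      using c ldist[of x y w] by (simp add: m_comm)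
  next
    fix x assume "x \<in> carrier M"
    then show "x \<otimes> \<zero> = \<zero>" using absorb[of x] z by (simp add: m_comm)
  qed (rule refl antisym trans total mono least absorb add; assumption)+
qed

lemma class_op_eq:
  assumes E: "equiv A E" and xy: "x \<in> A" "y \<in> A"
    and cong: "\<And>x x' y y'. (x, x') \<in> E \<Longrightarrow> (y, y') \<in> E \<Longrightarrow> (f x y, f x' y') \<in> E"
  shows "(\<Union>a\<in>E `` {x}. \<Union>b\<in>E `` {y}. E `` {f a b}) = E `` {f x y}"
proof -
  have 1: "E `` {f a b} = E `` {f x y}" if "a \<in> E `` {x}" "b \<in> E `` {y}" for a b
    by (rule equiv_class_eq[OF E, symmetric], rule cong) (use that in simp_all)
  have 2: "x \<in> E `` {x}" "y \<in> E `` {y}"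
    using equiv_class_self[OF E] xy by blast+
  have "(\<Union>a\<in>E `` {x}. \<Union>b\<in>E `` {y}. E `` {f a b}) = (\<Union>a\<in>E `` {x}. \<Union>b\<in>E `` {y}. E `` {f x y})"
    by (intro SUP_cong refl 1)
  also have "\<dots> = E `` {f x y}" using 2 by blast
  finally show ?thesis .
qed

lemma quotient_bipotent:
  fixes S :: "('s, 'a) ring_scheme" and Q :: "'s set osemiring"
  assumes S: "csemiring S" and E: "equiv (carrier S) E"
    and cong: "\<And>x x' y y'. (x, x') \<in> E \<Longrightarrow> (y, y') \<in> E \<Longrightarrow> (x \<otimes>\<^bsub>S\<^esub> y, x' \<otimes>\<^bsub>S\<^esub> y') \<in> E"
    and Q: "carrier Q = carrier S // E" "mult Q = class_mult S E"
      "one Q = E `` {\<one>\<^bsub>S\<^esub>}" "zero Q = E `` {\<zero>\<^bsub>S\<^esub>}"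
    and leq: "\<And>x y. \<lbrakk>x \<in> carrier S; y \<in> carrier S\<rbrakk> \<Longrightarrow> E `` {x} \<preceq>\<^bsub>Q\<^esub> E `` {y} \<longleftrightarrow> r x y"
    and add: "\<And>X Y. \<lbrakk>X \<in> carrier Q; Y \<in> carrier Q\<rbrakk> \<Longrightarrow> X \<oplus>\<^bsub>Q\<^esub> Y = omax Q X Y"
    and E_le: "\<And>x y. \<lbrakk>x \<in> carrier S; y \<in> carrier S\<rbrakk> \<Longrightarrow> (x, y) \<in> E \<longleftrightarrow> r x y \<and> r y x"
    and le_trans: "\<And>x y z. \<lbrakk>x \<in> carrier S; y \<in> carrier S; z \<in> carrier S; r x y; r y z\<rbrakk> \<Longrightarrow> r x z"
    and le_total: "\<And>x y. \<lbrakk>x \<in> carrier S; y \<in> carrier S\<rbrakk> \<Longrightarrow> r x y \<or> r y x"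
    and le_mono: "\<And>x y z. \<lbrakk>x \<in> carrier S; y \<in> carrier S; z \<in> carrier S; r x y\<rbrakk>
      \<Longrightarrow> r (x \<otimes>\<^bsub>S\<^esub> z) (y \<otimes>\<^bsub>S\<^esub> z)"
    and le_zero: "\<And>x. x \<in> carrier S \<Longrightarrow> r \<zero>\<^bsub>S\<^esub> x"
  shows "bipotent_semiring Q"
proof -
  interpret S: csemiring S by (rule S)
  have mult: "E `` {x} \<otimes>\<^bsub>Q\<^esub> E `` {y} = E `` {x \<otimes>\<^bsub>S\<^esub> y}"
    if "x \<in> carrier S" "y \<in> carrier S" for x y
    unfolding Q(2) class_mult_def
    by (rule class_op_eq[where f = "(\<otimes>\<^bsub>S\<^esub>)", OF E that]) (rule cong)
  have cls: "E `` {x} \<in> carrier Q" if "x \<in> carrier S" for x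
    using that by (simp add: Q quotientI)
  have eq: "E `` {x} = E `` {y} \<longleftrightarrow> r x y \<and> r y x" if "x \<in> carrier S" "y \<in> carrier S" for x y
    using that E_le by (simp add: eq_equiv_class_iff[OF E])
  have ex: "\<exists>x\<in>carrier S. X = E `` {x}" if "X \<in> carrier Q" for X
    using that by (auto simp: Q elim!: quotientE)
  show ?thesis
  proof (rule bipotent_semiringI)
    show "comm_monoid Q"
    proof (rule comm_monoidI)
      show "\<one>\<^bsub>Q\<^esub> \<in> carrier Q" using cls[of "\<one>\<^bsub>S\<^esub>"] by (simp add: Q)
    next
      fix X Y assume "X \<in> carrier Q" "Y \<in> carrier Q"
      then obtain x y where "x \<in> carrier S" "X = E `` {x}" "y \<in> carrier S" "Y = E `` {y}"
        by (metis ex)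
      then show "X \<otimes>\<^bsub>Q\<^esub> Y \<in> carrier Q" "X \<otimes>\<^bsub>Q\<^esub> Y = Y \<otimes>\<^bsub>Q\<^esub> X"
        by (simp_all add: mult cls S.m_comm)
    next
      fix X Y Z assume "X \<in> carrier Q" "Y \<in> carrier Q" "Z \<in> carrier Q"
      then obtain x y z where "x \<in> carrier S" "X = E `` {x}" "y \<in> carrier S" "Y = E `` {y}"
        "z \<in> carrier S" "Z = E `` {z}"
        by (metis ex)
      then show "X \<otimes>\<^bsub>Q\<^esub> Y \<otimes>\<^bsub>Q\<^esub> Z = X \<otimes>\<^bsub>Q\<^esub> (Y \<otimes>\<^bsub>Q\<^esub> Z)"
        by (simp add: mult S.m_assoc)
    next
      fix X assume "X \<in> carrier Q"
      then obtain x where x: "x \<in> carrier S" "X = E `` {x}" by (metis ex)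
      show "\<one>\<^bsub>Q\<^esub> \<otimes>\<^bsub>Q\<^esub> X = X"
        using x mult[of "\<one>\<^bsub>S\<^esub>" x] by (simp add: Q(3))
    qed
  next
    show "\<zero>\<^bsub>Q\<^esub> \<in> carrier Q" using cls[of "\<zero>\<^bsub>S\<^esub>"] by (simp add: Q)
  next
    fix X assume "X \<in> carrier Q"
    then obtain x where x: "x \<in> carrier S" "X = E `` {x}" by (metis ex)
    show "X \<preceq>\<^bsub>Q\<^esub> X" using x le_total[of x x] by (simp add: leq)
    show "\<zero>\<^bsub>Q\<^esub> \<preceq>\<^bsub>Q\<^esub> X" using x by (simp add: Q(4) leq le_zero)
    show "\<zero>\<^bsub>Q\<^esub> \<otimes>\<^bsub>Q\<^esub> X = \<zero>\<^bsub>Q\<^esub>" using x mult[of "\<zero>\<^bsub>S\<^esub>" x] by (simp add: Q(4))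
  next
    fix X Y assume c: "X \<in> carrier Q" "Y \<in> carrier Q"
    then obtain x y where xy: "x \<in> carrier S" "X = E `` {x}" "y \<in> carrier S" "Y = E `` {y}"
      by (metis ex)
    show "X \<preceq>\<^bsub>Q\<^esub> Y \<or> Y \<preceq>\<^bsub>Q\<^esub> X" using xy le_total by (simp add: leq)
    show "X = Y" if "X \<preceq>\<^bsub>Q\<^esub> Y" "Y \<preceq>\<^bsub>Q\<^esub> X" using that xy eq by (simp add: leq)
    show "X \<oplus>\<^bsub>Q\<^esub> Y = omax Q X Y" using c by (rule add)
  next
    fix X Y Z assume "X \<in> carrier Q" "Y \<in> carrier Q" "Z \<in> carrier Q"
    then obtain x y z where xyz: "x \<in> carrier S" "X = E `` {x}" "y \<in> carrier S" "Y = E `` {y}"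
      "z \<in> carrier S" "Z = E `` {z}"
      by (metis ex)
    show "X \<preceq>\<^bsub>Q\<^esub> Z" if "X \<preceq>\<^bsub>Q\<^esub> Y" "Y \<preceq>\<^bsub>Q\<^esub> Z"
      using that xyz le_trans[of x y z] by (simp add: leq)
    show "X \<otimes>\<^bsub>Q\<^esub> Z \<preceq>\<^bsub>Q\<^esub> Y \<otimes>\<^bsub>Q\<^esub> Z" if "X \<preceq>\<^bsub>Q\<^esub> Y"
      using that xyz le_mono[of x y z] by (simp add: leq mult)
  qed
qed

subsection \<open>$M(R,L)$ and $v_{R,L}$\<close>

lemma residual_rel_equiv: "equiv (carrier R) (residual_rel R L)"
  by (rule equivI) (auto simp: residual_rel_def refl_on_def sym_def trans_def)

lemma residual_leq_class:
  assumes "x \<in> carrier R" "y \<in> carrier R"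
  shows "residual_leq R L (residual_rel R L `` {y}) (residual_rel R L `` {x}) \<longleftrightarrow>
    residual R L x \<subseteq> residual R L y"
  using assms unfolding residual_leq_def residual_rel_def by auto

locale residual_setting = csemiring R for R (structure) +
  fixes L
  assumes L: "semiring_prime R L \<or> proper_CMC_subsemiring R L"
begin

lemma L_sub: "L \<subseteq> carrier R" and L_zero: "\<zero> \<in> L"
  using L by (auto simp: semiring_prime_def proper_CMC_subsemiring_def)

lemma L_add: "x \<in> L \<Longrightarrow> y \<in> L \<Longrightarrow> x \<oplus> y \<in> L" and L_mult: "x \<in> L \<Longrightarrow> y \<in> L \<Longrightarrow> x \<otimes> y \<in> L"
proof -
  have "add_closed R L" "mult_closed R L"
    using L by (auto simp: semiring_prime_def proper_CMC_subsemiring_def)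
  then show "x \<in> L \<Longrightarrow> y \<in> L \<Longrightarrow> x \<oplus> y \<in> L" "x \<in> L \<Longrightarrow> y \<in> L \<Longrightarrow> x \<otimes> y \<in> L"
    unfolding add_closed_def mult_closed_def by blast+
qed

lemma L_compl:
  assumes "x \<in> carrier R" "y \<in> carrier R" "x \<otimes> y \<in> L" "x \<notin> L"
  shows "y \<in> L"
proof -
  have "mult_closed R (carrier R - L)"
    using L by (auto simp: semiring_prime_def proper_CMC_subsemiring_def)
  then show ?thesis using assms unfolding mult_closed_def by blast
qed

lemma residual_mult_mono:
  assumes "x \<in> carrier R" "y \<in> carrier R" "z \<in> carrier R" "residual R L y \<subseteq> residual R L x"
  shows "residual R L (y \<otimes> z) \<subseteq> residual R L (x \<otimes> z)"
proof
  fix w assume "w \<in> residual R L (y \<otimes> z)"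
  then have w: "w \<in> carrier R" "w \<otimes> (y \<otimes> z) \<in> L" by (auto simp: residual_def)
  then have "(w \<otimes> z) \<otimes> y \<in> L" using assms by (simp add: m_ac)
  then have "(w \<otimes> z) \<otimes> x \<in> L" using assms w by (auto simp: residual_def)
  then show "w \<in> residual R L (x \<otimes> z)" using assms w by (simp add: residual_def m_ac)
qed

lemma residual_total:
  assumes "x \<in> carrier R" "y \<in> carrier R"
  shows "residual R L x \<subseteq> residual R L y \<or> residual R L y \<subseteq> residual R L x"
proof (rule ccontr)
  assume "\<not> ?thesis"
  then obtain z w where zw: "z \<in> carrier R" "w \<in> carrier R"
    "z \<otimes> x \<in> L" "z \<otimes> y \<notin> L" "w \<otimes> y \<in> L" "w \<otimes> x \<notin> L"
    by (auto simp: residual_def)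
  then have "(z \<otimes> x) \<otimes> (w \<otimes> y) \<in> L" by (simp add: L_mult)
  also have "(z \<otimes> x) \<otimes> (w \<otimes> y) = (z \<otimes> y) \<otimes> (w \<otimes> x)" using zw assms by (simp add: m_ac)
  finally show False using L_compl[of "z \<otimes> y" "w \<otimes> x"] zw assms by auto
qed

lemma residual_rel_mult:
  assumes "(x, x') \<in> residual_rel R L" "(y, y') \<in> residual_rel R L"
  shows "(x \<otimes> y, x' \<otimes> y') \<in> residual_rel R L"
proof -
  have c: "x \<in> carrier R" "x' \<in> carrier R" "y \<in> carrier R" "y' \<in> carrier R"
    and e: "residual R L x = residual R L x'" "residual R L y = residual R L y'"
    using assms by (auto simp: residual_rel_def)
  have "residual R L (x \<otimes> y) = residual R L (x' \<otimes> y)"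
    using residual_mult_mono[of x x' y] residual_mult_mono[of x' x y] c e by simp
  also have "\<dots> = residual R L (x' \<otimes> y')"
    using residual_mult_mono[of y y' x'] residual_mult_mono[of y' y x'] c e
    by (simp add: m_comm)
  finally show ?thesis using c by (simp add: residual_rel_def)
qed

lemma M_of_bipotent: "bipotent_semiring (M_of R L)"
proof (rule quotient_bipotent[where S = R and E = "residual_rel R L"
      and r = "\<lambda>y x. residual R L x \<subseteq> residual R L y"])
  show "csemiring R" by unfold_locales
next
  fix x assume "x \<in> carrier R"
  then show "residual R L x \<subseteq> residual R L \<zero>"
    using L_zero by (auto simp: residual_def)
next
  fix x y assume "x \<in> carrier R" "y \<in> carrier R"
  then show "residual R L y \<subseteq> residual R L x \<or> residual R L x \<subseteq> residual R L y"
    using residual_total by blast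
next
  fix x y assume "x \<in> carrier R" "y \<in> carrier R"
  then show "(x, y) \<in> residual_rel R L \<longleftrightarrow>
    residual R L y \<subseteq> residual R L x \<and> residual R L x \<subseteq> residual R L y"
    by (auto simp: residual_rel_def)
next
  fix x y z assume "x \<in> carrier R" "y \<in> carrier R" "z \<in> carrier R" "residual R L y \<subseteq> residual R L x"
  then show "residual R L (y \<otimes> z) \<subseteq> residual R L (x \<otimes> z)"
    by (rule residual_mult_mono)
next
  fix x x' y y' assume "(x, x') \<in> residual_rel R L" "(y, y') \<in> residual_rel R L"
  then show "(x \<otimes> y, x' \<otimes> y') \<in> residual_rel R L" by (rule residual_rel_mult)
next
  fix x y assume "x \<in> carrier R" "y \<in> carrier R"
  then show "residual_rel R L `` {x} \<preceq>\<^bsub>M_of R L\<^esub> residual_rel R L `` {y}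
    \<longleftrightarrow> residual R L y \<subseteq> residual R L x"
    by (simp add: M_of_def residual_leq_class)
qed (simp_all add: M_of_def omax_def residual_rel_equiv)

lemma v_of_m_valuation: "m_valuation R (M_of R L) (v_of R L)"
proof -
  interpret Q: bipotent_semiring "M_of R L" by (rule M_of_bipotent)
  show ?thesis
  proof unfold_locales
    fix x y assume c: "x \<in> carrier R" "y \<in> carrier R"
    show "v_of R L (x \<otimes> y) = v_of R L x \<otimes>\<^bsub>M_of R L\<^esub> v_of R L y"
      using class_op_eq[OF residual_rel_equiv c, of L "(\<otimes>)"]
      by (simp add: v_of_def M_of_def class_mult_def residual_rel_mult)
    have "residual R L x \<inter> residual R L y \<subseteq> residual R L (x \<oplus> y)"
      using c by (auto simp: residual_def r_distr L_add)
    then show "v_of R L (x \<oplus> y) \<preceq>\<^bsub>M_of R L\<^esub> omax (M_of R L) (v_of R L x) (v_of R L y)"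
      using c residual_total[OF c] by (auto simp: v_of_def M_of_def omax_def residual_leq_class)
  qed (auto simp: v_of_def M_of_def quotientI)
qed

end

subsection \<open>$M/C$ and $\pi_C$\<close>

context bipotent_semiring
begin

lemma nil_elements_mult:
  assumes x: "x \<in> nil_elements M" and y: "y \<in> carrier M"
  shows "x \<otimes> y \<in> nil_elements M"
proof -
  obtain n :: nat where "x \<in> carrier M" "x [^] n = \<zero>" using x by (auto simp: nil_elements_def)
  then have "(x \<otimes> y) [^] n = \<zero>" using y by (simp add: nat_pow_distrib)
  then show ?thesis using x y by (auto simp: nil_elements_def)
qed

lemma pow_mono:
  fixes n :: nat
  assumes "x \<preceq> y" "x \<in> carrier M" "y \<in> carrier M"
  shows "x [^] n \<preceq> y [^] n"
proof (induction n)
  case 0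
  show ?case using leq_refl[of \<one>] by simp
next
  case (Suc n)
  have "x [^] n \<otimes> x \<preceq> y [^] n \<otimes> x" using Suc assms by (intro mult_mono) auto
  moreover have "x \<otimes> y [^] n \<preceq> y \<otimes> y [^] n" using assms by (intro mult_mono) auto
  then have "y [^] n \<otimes> x \<preceq> y [^] n \<otimes> y"
    using assms by (simp add: m_comm[of "y [^] n" x] m_comm[of "y [^] n" y])
  ultimately have "x [^] n \<otimes> x \<preceq> y [^] n \<otimes> y"
    by (rule leq_trans) (use assms in auto)
  then show ?case by simp
qed

lemma nil_elements_down:
  assumes "x \<preceq> y" "x \<in> carrier M" "y \<in> nil_elements M"
  shows "x \<in> nil_elements M"
proof -
  obtain n :: nat where n: "y \<in> carrier M" "y [^] n = \<zero>"
    using assms by (auto simp: nil_elements_def)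
  then have "x [^] n \<preceq> \<zero>" using pow_mono[of x y n] assms by simp
  then have "x [^] n = \<zero>" by (rule leq_antisym) (use assms zero_least in auto)
  then show ?thesis using assms by (auto simp: nil_elements_def)
qed

lemma nil_elements_prime:
  assumes "x \<in> carrier M" "y \<in> carrier M" "x \<otimes> y \<in> nil_elements M"
  shows "x \<in> nil_elements M \<or> y \<in> nil_elements M"
proof -
  have *: "u \<in> nil_elements M"
    if u: "u \<in> carrier M" "w \<in> carrier M" "u \<preceq> w" "u \<otimes> w \<in> nil_elements M" for u w
  proof -
    have "u \<otimes> u \<preceq> w \<otimes> u" using u by (intro mult_mono) auto
    then have "u \<otimes> u \<in> nil_elements M"
      using u nil_elements_down[of "u \<otimes> u" "u \<otimes> w"] by (simp add: m_comm[of w u])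
    then obtain n :: nat where "(u \<otimes> u) [^] n = \<zero>" by (auto simp: nil_elements_def)
    then have "u [^] (n + n) = \<zero>"
      using u by (simp add: nat_pow_distrib nat_pow_mult[symmetric])
    then show ?thesis using u(1) unfolding nil_elements_def by blast
  qed
  from leq_total[OF assms(1,2)] show ?thesis
  proof
    assume "x \<preceq> y"
    then show ?thesis using *[of x y] assms by simp
  next
    assume "y \<preceq> x"
    then show ?thesis using *[of y x] assms by (simp add: m_comm[of y x])
  qed
qed

lemma min_cancel_relE:
  assumes "(x, y) \<in> min_cancel_rel M"
  obtains "x \<in> nil_elements M" "y \<in> nil_elements M"
  | s where "x \<in> carrier M" "y \<in> carrier M" "s \<in> carrier M" "s \<notin> nil_elements M" "s \<otimes> x = s \<otimes> y"
  using assms unfolding min_cancel_rel_def by auto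

lemma min_cancel_rel_carrier:
  assumes "(x, y) \<in> min_cancel_rel M"
  shows "x \<in> carrier M" "y \<in> carrier M"
  using assms by (auto simp: min_cancel_rel_def)

lemma min_cancel_relI:
  assumes "x \<in> carrier M" "y \<in> carrier M" "s \<in> carrier M" "s \<notin> nil_elements M" "s \<otimes> x = s \<otimes> y"
  shows "(x, y) \<in> min_cancel_rel M"
  using assms unfolding min_cancel_rel_def by auto

text \<open>Cancellation by a non-nilpotent \<open>s\<close> cannot connect \<open>nil_elements M\<close> to its complement.\<close>

lemma min_cancel_rel_nil:
  assumes "(x, y) \<in> min_cancel_rel M"
  shows "x \<in> nil_elements M \<longleftrightarrow> y \<in> nil_elements M"
proof -
  have *: "b \<in> nil_elements M" if ab: "a \<in> carrier M" "b \<in> carrier M"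
    "s \<in> carrier M" "s \<notin> nil_elements M" "s \<otimes> a = s \<otimes> b" "a \<in> nil_elements M" for a b s
  proof -
    have "a \<otimes> s \<in> nil_elements M" using ab by (intro nil_elements_mult)
    moreover have "a \<otimes> s = s \<otimes> b" using ab(5) m_comm[OF ab(1,3)] by (rule trans[rotated])
    ultimately show ?thesis using nil_elements_prime[OF ab(3,2)] ab(4) by metis
  qed
  from assms show ?thesis
  proof (cases rule: min_cancel_relE)
    case 1
    then show ?thesis by blast
  next
    case (2 s)
    then show ?thesis using *[of x y s] *[of y x s] by metis
  qed
qed

lemma min_cancel_rel_refl: "x \<in> carrier M \<Longrightarrow> (x, x) \<in> min_cancel_rel M"
proof (cases "\<one> \<in> nil_elements M")
  case True
  assume "x \<in> carrier M"
  then show ?thesis using nil_elements_mult[OF True, of x] by (simp add: min_cancel_rel_def)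
next
  case False
  assume "x \<in> carrier M"
  then show ?thesis using False by (intro min_cancel_relI[of _ _ \<one>]) auto
qed

lemma min_cancel_rel_sym:
  assumes "(x, y) \<in> min_cancel_rel M"
  shows "(y, x) \<in> min_cancel_rel M"
  using assms
proof (cases rule: min_cancel_relE)
  case 1
  then show ?thesis using min_cancel_rel_carrier[OF assms] by (simp add: min_cancel_rel_def)
next
  case (2 s)
  then show ?thesis by (intro min_cancel_relI[of _ _ s]) auto
qed

lemma min_cancel_rel_trans:
  assumes xy: "(x, y) \<in> min_cancel_rel M" and yz: "(y, z) \<in> min_cancel_rel M"
  shows "(x, z) \<in> min_cancel_rel M"
proof (cases "y \<in> nil_elements M")
  case True
  then show ?thesis
    using min_cancel_rel_nil[OF xy] min_cancel_rel_nil[OF yz] min_cancel_rel_carrier[OF xy]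
      min_cancel_rel_carrier[OF yz] by (simp add: min_cancel_rel_def)
next
  case False
  obtain s t where c: "x \<in> carrier M" "y \<in> carrier M" "z \<in> carrier M" "s \<in> carrier M" "t \<in> carrier M"
    and st: "s \<notin> nil_elements M" "t \<notin> nil_elements M" "s \<otimes> x = s \<otimes> y" "t \<otimes> y = t \<otimes> z"
    using False xy yz by (elim min_cancel_relE) blast+
  have "(s \<otimes> t) \<otimes> x = t \<otimes> (s \<otimes> x)" using c by (simp add: m_ac)
  also have "\<dots> = t \<otimes> (s \<otimes> y)" by (simp only: st)
  also have "\<dots> = s \<otimes> (t \<otimes> y)" using c by (simp add: m_ac)
  also have "\<dots> = s \<otimes> (t \<otimes> z)" by (simp only: st)
  also have "\<dots> = (s \<otimes> t) \<otimes> z" using c by (simp add: m_ac)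
  finally show ?thesis
    using c st nil_elements_prime[of s t] by (intro min_cancel_relI[of _ _ "s \<otimes> t"]) auto
qed

lemma min_cancel_rel_equiv: "equiv (carrier M) (min_cancel_rel M)"
proof (rule equivI)
  show "refl_on (carrier M) (min_cancel_rel M)"
    by (simp add: refl_on_def min_cancel_rel_refl)
  show "sym (min_cancel_rel M)"
    using min_cancel_rel_sym by (rule symI)
  show "trans (min_cancel_rel M)"
    using min_cancel_rel_trans by (rule transI)
qed (auto simp: min_cancel_rel_def)

lemma min_cancel_rel_mult_right:
  assumes xy: "(x, y) \<in> min_cancel_rel M" and z: "z \<in> carrier M"
  shows "(x \<otimes> z, y \<otimes> z) \<in> min_cancel_rel M"
  using xy
proof (cases rule: min_cancel_relE)
  case 1
  then show ?thesis
    using min_cancel_rel_carrier[OF xy] z nil_elements_mult by (simp add: min_cancel_rel_def)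
next
  case (2 s)
  then have "s \<otimes> (x \<otimes> z) = s \<otimes> (y \<otimes> z)" using z by (simp add: m_assoc[symmetric])
  then show ?thesis using 2 z by (intro min_cancel_relI[of _ _ s]) auto
qed

lemma min_cancel_rel_mult:
  assumes "(x, x') \<in> min_cancel_rel M" "(y, y') \<in> min_cancel_rel M"
  shows "(x \<otimes> y, x' \<otimes> y') \<in> min_cancel_rel M"
proof -
  note c = min_cancel_rel_carrier[OF assms(1)] min_cancel_rel_carrier[OF assms(2)]
  have "(x \<otimes> y, x' \<otimes> y) \<in> min_cancel_rel M"
    using min_cancel_rel_mult_right[OF assms(1)] c by blast
  moreover have "(x' \<otimes> y, x' \<otimes> y') \<in> min_cancel_rel M"
    using min_cancel_rel_mult_right[OF assms(2), of x'] c by (simp add: m_comm)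
  ultimately show ?thesis by (rule min_cancel_rel_trans)
qed

lemma min_cancel_rel_convex:
  assumes xz: "(x, z) \<in> min_cancel_rel M" and y: "y \<in> carrier M" "x \<preceq> y" "y \<preceq> z"
  shows "(x, y) \<in> min_cancel_rel M"
  using xz
proof (cases rule: min_cancel_relE)
  case 1
  then show ?thesis
    using y nil_elements_down[of y z] min_cancel_rel_carrier[OF xz] by (simp add: min_cancel_rel_def)
next
  case (2 s)
  then have "s \<otimes> x \<preceq> s \<otimes> y" "s \<otimes> y \<preceq> s \<otimes> z"
    using y mult_mono[of x y s] mult_mono[of y z s] by (simp_all add: m_comm)
  then have "s \<otimes> x = s \<otimes> y" using 2 y by (intro leq_antisym) auto
  then show ?thesis using 2 y by (intro min_cancel_relI[of _ _ s]) auto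
qed

definition C_leq :: "'a \<Rightarrow> 'a \<Rightarrow> bool"
  where "C_leq x y \<longleftrightarrow> x \<preceq> y \<or> (x, y) \<in> min_cancel_rel M"

lemma C_leq_trans:
  assumes c: "x \<in> carrier M" "y \<in> carrier M" "z \<in> carrier M" and le: "C_leq x y" "C_leq y z"
  shows "C_leq x z"
proof (cases "x \<preceq> z")
  case False
  then have zx: "z \<preceq> x" using c leq_total by blast
  show ?thesis
    using le unfolding C_leq_def
  proof (elim disjE)
    assume "x \<preceq> y" "y \<preceq> z"
    then show "x \<preceq> z \<or> (x, z) \<in> min_cancel_rel M" using c leq_trans[of x y z] by blast
  next
    assume "x \<preceq> y" "(y, z) \<in> min_cancel_rel M"
    then show "x \<preceq> z \<or> (x, z) \<in> min_cancel_rel M"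
      using min_cancel_rel_convex[of z y x] zx c min_cancel_rel_sym[of y z] min_cancel_rel_sym[of z x] by blast
  next
    assume "(x, y) \<in> min_cancel_rel M" "y \<preceq> z"
    then show "x \<preceq> z \<or> (x, z) \<in> min_cancel_rel M"
      using min_cancel_rel_convex[of y x z] zx c min_cancel_rel_sym[of x y]
        min_cancel_rel_trans[of x y z] min_cancel_rel_trans[of x y x] by blast
  next
    assume "(x, y) \<in> min_cancel_rel M" "(y, z) \<in> min_cancel_rel M"
    then show "x \<preceq> z \<or> (x, z) \<in> min_cancel_rel M" using min_cancel_rel_trans[of x y z] by blast
  qed
qed (simp add: C_leq_def)

lemma C_leq_class:
  assumes c: "x \<in> carrier M" "y \<in> carrier M"
  shows "min_cancel_rel M `` {x} \<preceq>\<^bsub>quotient_semiring M (min_cancel_rel M)\<^esub> min_cancel_rel M `` {y}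
    \<longleftrightarrow> C_leq x y" (is "?l \<longleftrightarrow> _")
proof
  assume ?l
  then obtain x' y' where "(x, x') \<in> min_cancel_rel M" "(y, y') \<in> min_cancel_rel M" "x' \<preceq> y'"
    by (auto simp: quotient_semiring_def)
  moreover from this have "x' \<in> carrier M" "y' \<in> carrier M" using min_cancel_rel_carrier by blast+
  ultimately show "C_leq x y"
    using c C_leq_trans[of x x' y] C_leq_trans[of x' y' y] min_cancel_rel_sym[of y y']
    unfolding C_leq_def by blast
next
  assume "C_leq x y"
  then show ?l
    using min_cancel_rel_refl[OF c(1)] min_cancel_rel_refl[OF c(2)] leq_refl[OF c(2)]
    unfolding C_leq_def quotient_semiring_def by auto
qed

lemma C_leq_antisym:
  assumes "x \<in> carrier M" "y \<in> carrier M"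
  shows "(x, y) \<in> min_cancel_rel M \<longleftrightarrow> C_leq x y \<and> C_leq y x"
  using assms min_cancel_rel_sym[of x y] min_cancel_rel_sym[of y x] leq_antisym[of x y]
    min_cancel_rel_refl[of x] unfolding C_leq_def by blast

lemma min_cancel_rel_add:
  assumes "(x, x') \<in> min_cancel_rel M" "(y, y') \<in> min_cancel_rel M"
  shows "(x \<oplus> y, x' \<oplus> y') \<in> min_cancel_rel M"
proof -
  have max: "C_leq (a \<oplus> b) (a' \<oplus> b')"
    if r: "(a, a') \<in> min_cancel_rel M" "(b, b') \<in> min_cancel_rel M" for a a' b b'
  proof -
    note c = min_cancel_rel_carrier[OF r(1)] min_cancel_rel_carrier[OF r(2)]
    have "a' \<preceq> a' \<oplus> b'" "b' \<preceq> a' \<oplus> b'"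
      using c leq_total[of a' b'] leq_refl by (auto simp: add_eq_max omax_def)
    then have "C_leq a (a' \<oplus> b')" "C_leq b (a' \<oplus> b')"
      using r c C_leq_trans[of a a' "a' \<oplus> b'"] C_leq_trans[of b b' "a' \<oplus> b'"]
      by (simp_all add: C_leq_def)
    then show ?thesis using c by (auto simp: add_eq_max omax_def split: if_splits)
  qed
  note c = min_cancel_rel_carrier[OF assms(1)] min_cancel_rel_carrier[OF assms(2)]
  show ?thesis
    using c max[OF assms] max[OF assms[THEN min_cancel_rel_sym]] by (simp add: C_leq_antisym)
qed

lemma quotient_C_add:
  assumes c: "x \<in> carrier M" "y \<in> carrier M"
  shows "min_cancel_rel M `` {x} \<oplus>\<^bsub>quotient_semiring M (min_cancel_rel M)\<^esub> min_cancel_rel M `` {y}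
    = min_cancel_rel M `` {x \<oplus> y}"
proof -
  have "(\<Union>a\<in>min_cancel_rel M `` {x}. \<Union>b\<in>min_cancel_rel M `` {y}. min_cancel_rel M `` {a \<oplus> b})
    = min_cancel_rel M `` {x \<oplus> y}"
    by (rule class_op_eq[where f = "(\<oplus>)", OF min_cancel_rel_equiv c]) (rule min_cancel_rel_add)
  then show ?thesis by (simp add: quotient_semiring_def class_add_def)
qed

lemma quotient_C_mult:
  assumes c: "x \<in> carrier M" "y \<in> carrier M"
  shows "min_cancel_rel M `` {x} \<otimes>\<^bsub>quotient_semiring M (min_cancel_rel M)\<^esub> min_cancel_rel M `` {y}
    = min_cancel_rel M `` {x \<otimes> y}"
proof -
  have "(\<Union>a\<in>min_cancel_rel M `` {x}. \<Union>b\<in>min_cancel_rel M `` {y}. min_cancel_rel M `` {a \<otimes> b})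
    = min_cancel_rel M `` {x \<otimes> y}"
    by (rule class_op_eq[where f = "(\<otimes>)", OF min_cancel_rel_equiv c]) (rule min_cancel_rel_mult)
  then show ?thesis by (simp add: quotient_semiring_def class_mult_def)
qed

lemma quotient_C_bipotent: "bipotent_semiring (quotient_semiring M (min_cancel_rel M))"
  (is "bipotent_semiring ?Q")
proof (rule quotient_bipotent[where S = M and E = "min_cancel_rel M" and r = C_leq])
  show "csemiring M" by unfold_locales
  show "equiv (carrier M) (min_cancel_rel M)" by (rule min_cancel_rel_equiv)
next
  fix X Y assume "X \<in> carrier ?Q" "Y \<in> carrier ?Q"
  then obtain x y where x: "x \<in> carrier M" and X: "X = min_cancel_rel M `` {x}"
    and y: "y \<in> carrier M" and Y: "Y = min_cancel_rel M `` {y}"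
    by (auto simp: quotient_semiring_def elim!: quotientE)
  have le: "X \<preceq>\<^bsub>?Q\<^esub> Y \<longleftrightarrow> C_leq x y" unfolding X Y by (rule C_leq_class[OF x y])
  have sum: "X \<oplus>\<^bsub>?Q\<^esub> Y = min_cancel_rel M `` {x \<oplus> y}" unfolding X Y by (rule quotient_C_add[OF x y])
  show "X \<oplus>\<^bsub>?Q\<^esub> Y = omax ?Q X Y"
  proof (cases "x \<preceq> y")
    case True
    then have "x \<oplus> y = y" "C_leq x y" by (simp_all add: add_eq_max[OF x y] omax_def C_leq_def)
    then show ?thesis by (simp add: sum le omax_def Y[symmetric])
  next
    case False
    then have sum': "x \<oplus> y = x" by (simp add: add_eq_max[OF x y] omax_def)
    have "X = Y" if "C_leq x y"
      unfolding X Y using that False equiv_class_eq[OF min_cancel_rel_equiv, of x y]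
      by (simp add: C_leq_def)
    then show ?thesis unfolding sum sum' omax_def le X[symmetric] by simp
  qed
next
  fix x x' y y' assume "(x, x') \<in> min_cancel_rel M" "(y, y') \<in> min_cancel_rel M"
  then show "(x \<otimes> y, x' \<otimes> y') \<in> min_cancel_rel M" by (rule min_cancel_rel_mult)
next
  fix x y z assume "x \<in> carrier M" "y \<in> carrier M" "z \<in> carrier M" "C_leq x y"
  then show "C_leq (x \<otimes> z) (y \<otimes> z)"
    using mult_mono[of x y z] min_cancel_rel_mult_right[of x y z] unfolding C_leq_def by blast
next
  fix x y z assume "x \<in> carrier M" "y \<in> carrier M" "z \<in> carrier M" "C_leq x y" "C_leq y z"
  then show "C_leq x z" by (rule C_leq_trans)
next
  fix x y assume c: "x \<in> carrier M" "y \<in> carrier M"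
  show "C_leq x y \<or> C_leq y x" using leq_total[OF c] unfolding C_leq_def by blast
  show "min_cancel_rel M `` {x} \<preceq>\<^bsub>?Q\<^esub> min_cancel_rel M `` {y} \<longleftrightarrow> C_leq x y"
    by (rule C_leq_class[OF c])
  show "(x, y) \<in> min_cancel_rel M \<longleftrightarrow> C_leq x y \<and> C_leq y x"
    by (rule C_leq_antisym[OF c])
next
  fix x assume "x \<in> carrier M"
  then show "C_leq \<zero> x" unfolding C_leq_def by (intro disjI1 zero_least)
qed (simp_all add: quotient_semiring_def)

end

lemma quotient_C_m_valuation:
  fixes M (structure)
  assumes "m_valuation R M v"
  shows "m_valuation R (quotient_semiring M (min_cancel_rel M)) (quotient_map (min_cancel_rel M) \<circ> v)"
proof -
  interpret m_valuation R M v by (rule assms)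
  interpret Q: bipotent_semiring "quotient_semiring M (min_cancel_rel M)"
    by (rule M.quotient_C_bipotent)
  show ?thesis
  proof unfold_locales
    fix x y assume c: "x \<in> carrier R" "y \<in> carrier R"
    then have vc: "v x \<in> carrier M" "v y \<in> carrier M" "v (x \<oplus>\<^bsub>R\<^esub> y) \<in> carrier M"
      using v_closed by auto
    show "(quotient_map (min_cancel_rel M) \<circ> v) (x \<otimes>\<^bsub>R\<^esub> y) =
      (quotient_map (min_cancel_rel M) \<circ> v) x \<otimes>\<^bsub>quotient_semiring M (min_cancel_rel M)\<^esub>
      (quotient_map (min_cancel_rel M) \<circ> v) y"
      by (simp add: quotient_map_def M.quotient_C_mult[OF vc(1,2)] v_mult[OF c])
    have 1: "M.C_leq (v (x \<oplus>\<^bsub>R\<^esub> y)) (v x) \<and> v (x \<oplus>\<^bsub>R\<^esub> y) \<preceq> v x \<or>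
      M.C_leq (v (x \<oplus>\<^bsub>R\<^esub> y)) (v y) \<and> v x \<preceq> v y"
      using v_add[OF c] by (auto simp: M.C_leq_def omax_def split: if_splits)
    have "M.C_leq (v (x \<oplus>\<^bsub>R\<^esub> y)) (if M.C_leq (v x) (v y) then v y else v x)"
      using 1 M.C_leq_trans[OF vc(3,1,2)] by (auto simp: M.C_leq_def[of "v x" "v y"])
    then show "(quotient_map (min_cancel_rel M) \<circ> v) (x \<oplus>\<^bsub>R\<^esub> y)
      \<preceq>\<^bsub>quotient_semiring M (min_cancel_rel M)\<^esub> omax (quotient_semiring M (min_cancel_rel M))
        ((quotient_map (min_cancel_rel M) \<circ> v) x) ((quotient_map (min_cancel_rel M) \<circ> v) y)"
      using vc by (auto simp: quotient_map_def omax_def M.C_leq_class split: if_splits)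
  next
    show "quotient_map (min_cancel_rel M) \<circ> v \<in> carrier R \<rightarrow> carrier (quotient_semiring M (min_cancel_rel M))"
      using v_closed by (auto simp: quotient_map_def quotient_semiring_def intro!: quotientI)
  qed (simp_all add: quotient_map_def quotient_semiring_def v_zero v_one)
qed

end

theory Submission
  imports Defs
begin

text \<open>
  An m-valuation into a nonzero bipotent semiring is equivalent to some \<open>v\<^bsub>R,\<pp>\<^esub>\<close>
  (resp. \<open>v\<^bsub>R,A\<^esub>\<close>) iff it has UIC with strictness on the left (resp. right), where
  \<open>\<pp> = {x. v x < 1}\<close> (resp. \<open>A = {x. v x \<le> 1}\<close>). An m-valuation with UIC into a nonzero
  cancellative one, such as \<open>M/C\<close>, satisfies one of the two strict forms: otherwise there would be
  values \<open>t < 1 < u\<close> such that no value \<open>w\<close> has \<open>w < 1 \<le> w u\<close> and none has \<open>w t \<le> 1 < w\<close>;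
  the first excludes \<open>t u \<ge> 1\<close> (take \<open>w = t\<close>), the second excludes \<open>t u \<le> 1\<close> (take \<open>w = u\<close>).
\<close>

section \<open>Strict forms of unit incapsulation\<close>

definition left_strict_UIC :: "('r, 'a) ring_scheme \<Rightarrow> ('m, 'b) osemiring_scheme \<Rightarrow> ('r \<Rightarrow> 'm) \<Rightarrow> bool"
  where "left_strict_UIC R M v \<longleftrightarrow>
    (\<forall>x\<in>carrier R. \<forall>y\<in>carrier R. v x \<prec>\<^bsub>M\<^esub> v y \<longrightarrow>
      (\<exists>z\<in>carrier R. v (x \<otimes>\<^bsub>R\<^esub> z) \<prec>\<^bsub>M\<^esub> \<one>\<^bsub>M\<^esub> \<and> \<one>\<^bsub>M\<^esub> \<preceq>\<^bsub>M\<^esub> v (y \<otimes>\<^bsub>R\<^esub> z)))"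

definition right_strict_UIC :: "('r, 'a) ring_scheme \<Rightarrow> ('m, 'b) osemiring_scheme \<Rightarrow> ('r \<Rightarrow> 'm) \<Rightarrow> bool"
  where "right_strict_UIC R M v \<longleftrightarrow>
    (\<forall>x\<in>carrier R. \<forall>y\<in>carrier R. v x \<prec>\<^bsub>M\<^esub> v y \<longrightarrow>
      (\<exists>z\<in>carrier R. v (x \<otimes>\<^bsub>R\<^esub> z) \<preceq>\<^bsub>M\<^esub> \<one>\<^bsub>M\<^esub> \<and> \<one>\<^bsub>M\<^esub> \<prec>\<^bsub>M\<^esub> v (y \<otimes>\<^bsub>R\<^esub> z)))"

lemma left_strict_UIC_imp_UIC: "left_strict_UIC R M v \<Longrightarrow> UIC R M v"
  unfolding left_strict_UIC_def UIC_def lt_def by blast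

lemma right_strict_UIC_imp_UIC: "right_strict_UIC R M v \<Longrightarrow> UIC R M v"
  unfolding right_strict_UIC_def UIC_def lt_def by blast

section \<open>Strict inequalities in a bipotent semiring\<close>

context bipotent_semiring
begin

lemma lt_iff_not_leq: "\<lbrakk>x \<in> carrier M; y \<in> carrier M\<rbrakk> \<Longrightarrow> x \<prec> y \<longleftrightarrow> \<not> y \<preceq> x"
  using leq_total[of x y] leq_antisym[of x y] leq_refl[of x] by (auto simp: lt_def)

lemma mult_mono2:
  assumes "x \<preceq> x'" "y \<preceq> y'" "x \<in> carrier M" "x' \<in> carrier M" "y \<in> carrier M" "y' \<in> carrier M"
  shows "x \<otimes> y \<preceq> x' \<otimes> y'"
proof (rule leq_trans)
  show "x \<otimes> y \<preceq> x' \<otimes> y" using assms by (intro mult_mono)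
  show "x' \<otimes> y \<preceq> x' \<otimes> y'" using mult_mono[of y y' x'] assms by (simp add: m_comm)
qed (use assms in auto)

text \<open>Multiplication is only weakly monotone, so strictness comes from the factor
  \<open>y\<close>: \<open>x \<otimes> y \<preceq> y \<prec> \<one>\<close>. This will make {x. v x
  < 1} closed under products.\<close>

lemma mult_lt_one:
  assumes "x \<prec> \<one>" "y \<prec> \<one>" "x \<in> carrier M" "y \<in> carrier M"
  shows "x \<otimes> y \<prec> \<one>"
proof -
  have "x \<otimes> y \<preceq> \<one> \<otimes> y" using assms by (intro mult_mono) (auto simp: lt_def)
  moreover have "\<not> \<one> \<preceq> y" using assms by (simp add: lt_iff_not_leq)
  ultimately have "\<not> \<one> \<preceq> x \<otimes> y" using assms leq_trans[of \<one> "x \<otimes> y" y] by auto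
  then show ?thesis using assms by (simp add: lt_iff_not_leq)
qed

text \<open>Dually \<open>\<one> \<prec> y \<preceq> x \<otimes> y\<close>. This will make the
  complement of {x. v x \<le> 1} closed under products.\<close>

lemma one_lt_mult:
  assumes "\<one> \<prec> x" "\<one> \<prec> y" "x \<in> carrier M" "y \<in> carrier M"
  shows "\<one> \<prec> x \<otimes> y"
proof -
  have "\<one> \<otimes> y \<preceq> x \<otimes> y" using assms by (intro mult_mono) (auto simp: lt_def)
  moreover have "\<not> y \<preceq> \<one>" using assms by (simp add: lt_iff_not_leq)
  ultimately have "\<not> x \<otimes> y \<preceq> \<one>" using assms leq_trans[of y "x \<otimes> y" \<one>] by auto
  then show ?thesis using assms by (simp add: lt_iff_not_leq)
qed

lemma zero_lt_iff: "x \<in> carrier M \<Longrightarrow> \<zero> \<prec> x \<longleftrightarrow> x \<noteq> \<zero>"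
  using zero_least[of x] by (auto simp: lt_def)

section \<open>Nilpotent elements and cancellation in M/C\<close>

lemma one_in_nil_elements_iff: "\<one> \<in> nil_elements M \<longleftrightarrow> \<one> = \<zero>"
  by (auto simp: nil_elements_def)

lemma min_cancel_rel_zero_iff: "(x, \<zero>) \<in> min_cancel_rel M \<longleftrightarrow> x \<in> nil_elements M"
proof -
  \<comment> \<open>The exponent is 1, since the zeroth power of \<open>\<zero>\<close> is
    \<open>\<one>\<close>.\<close>
  have "\<zero> [^] (1::nat) = \<zero>" by simp
  then have "\<zero> \<in> nil_elements M" unfolding nil_elements_def by blast
  then show ?thesis
    using min_cancel_rel_nil[of x \<zero>] by (auto simp: min_cancel_rel_def nil_elements_def)
qed

lemma quotient_C_class_eq_iff:
  "\<lbrakk>x \<in> carrier M; y \<in> carrier M\<rbrakk> \<Longrightarrow>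
    min_cancel_rel M `` {x} = min_cancel_rel M `` {y} \<longleftrightarrow> (x, y) \<in> min_cancel_rel M"
  by (rule eq_equiv_class_iff[OF min_cancel_rel_equiv])

text \<open>Powers of \<open>\<one>\<close> are \<open>\<one>\<close>, so it falls into the class of
  \<open>\<zero>\<close>, which consists of the nilpotent elements, only in the zero semiring.
  Nontriviality thus passes from M to M/C.\<close>

lemma quotient_C_one_eq_zero_iff:
  "\<one>\<^bsub>quotient_semiring M (min_cancel_rel M)\<^esub> = \<zero>\<^bsub>quotient_semiring M (min_cancel_rel M)\<^esub> \<longleftrightarrow> \<one> = \<zero>"
  by (simp add: quotient_semiring_def quotient_C_class_eq_iff min_cancel_rel_zero_iff
      one_in_nil_elements_iff)

text \<open>A witness \<open>s\<close> for the products turns into the witness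
  \<open>s \<otimes> z\<close> for \<open>x\<close> and \<open>y\<close>, which is not nilpotent
  because a product is nilpotent only if one of its factors is. The same fact settles the case of
  two nilpotent products.\<close>

lemma min_cancel_rel_cancel:
  assumes c: "x \<in> carrier M" "y \<in> carrier M" "z \<in> carrier M"
    and xz: "(x \<otimes> z, y \<otimes> z) \<in> min_cancel_rel M" and z: "z \<notin> nil_elements M"
  shows "(x, y) \<in> min_cancel_rel M"
  using xz
proof (cases rule: min_cancel_relE)
  case 1
  then show ?thesis
    using c z nil_elements_prime[of x z] nil_elements_prime[of y z] by (simp add: min_cancel_rel_def)
next
  case (2 s)
  have "(s \<otimes> z) \<otimes> x = (s \<otimes> z) \<otimes> y"
    using 2 c m_assoc[of s z] m_comm[of x z] m_comm[of y z] by simp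
  moreover have "s \<otimes> z \<notin> nil_elements M" using 2 c z nil_elements_prime[of s z] by blast
  ultimately show ?thesis using 2 c by (intro min_cancel_relI[of _ _ "s \<otimes> z"]) auto
qed

text \<open>A nonzero class has a non-nilpotent representative, so
  \<open>min_cancel_rel_cancel\<close> applies to representatives. This supplies the cancellation
  hypothesis of \<open>UIC_cancellative_strict\<close> for M/C.\<close>

lemma quotient_C_cancel:
  fixes Q defines "Q \<equiv> quotient_semiring M (min_cancel_rel M)"
  assumes XYZ: "X \<in> carrier Q" "Y \<in> carrier Q" "Z \<in> carrier Q"
    and Z: "Z \<noteq> \<zero>\<^bsub>Q\<^esub>" and eq: "X \<otimes>\<^bsub>Q\<^esub> Z = Y \<otimes>\<^bsub>Q\<^esub> Z"
  shows "X = Y"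
proof -
  obtain x y z where c: "x \<in> carrier M" "y \<in> carrier M" "z \<in> carrier M"
    and cls: "X = min_cancel_rel M `` {x}" "Y = min_cancel_rel M `` {y}" "Z = min_cancel_rel M `` {z}"
    using XYZ unfolding Q_def by (auto simp: quotient_semiring_def elim!: quotientE)
  have zero: "\<zero>\<^bsub>Q\<^esub> = min_cancel_rel M `` {\<zero>}" by (simp add: Q_def quotient_semiring_def)
  have "z \<notin> nil_elements M"
    using Z c by (simp add: zero cls quotient_C_class_eq_iff min_cancel_rel_zero_iff)
  moreover have "(x \<otimes> z, y \<otimes> z) \<in> min_cancel_rel M"
    using eq c unfolding cls Q_def by (simp add: quotient_C_mult quotient_C_class_eq_iff)
  ultimately show ?thesis
    using min_cancel_rel_cancel[of x y z] c by (simp add: cls quotient_C_class_eq_iff)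
qed

end

section \<open>Equivalence with \<open>v_of R L\<close> expressed by residuals\<close>

lemma (in csemiring) v_of_leq_iff:
  "\<lbrakk>x \<in> carrier R; y \<in> carrier R\<rbrakk> \<Longrightarrow>
    v_of R L x \<preceq>\<^bsub>M_of R L\<^esub> v_of R L y \<longleftrightarrow> residual R L y \<subseteq> residual R L x"
  by (simp add: v_of_def M_of_def residual_leq_class)

lemma equivalent_v_of_iff:
  assumes "csemiring R"
  shows "equivalent_valuations R M v (M_of R L) (v_of R L) \<longleftrightarrow>
    (\<forall>x\<in>carrier R. \<forall>y\<in>carrier R. v x \<preceq>\<^bsub>M\<^esub> v y \<longleftrightarrow> residual R L y \<subseteq> residual R L x)"
  using csemiring.v_of_leq_iff[OF assms] unfolding equivalent_valuations_def by metis

context m_valuation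
begin

lemma v_carrier [simp]: "x \<in> carrier R \<Longrightarrow> v x \<in> carrier M"
  using v_closed by auto

lemma v_mult_left_mono:
  assumes "v x \<preceq>\<^bsub>M\<^esub> v y" "x \<in> carrier R" "y \<in> carrier R" "z \<in> carrier R"
  shows "v (z \<otimes>\<^bsub>R\<^esub> x) \<preceq>\<^bsub>M\<^esub> v (z \<otimes>\<^bsub>R\<^esub> y)"
  using assms M.mult_mono[of "v x" "v y" "v z"] by (simp add: v_mult M.m_comm)

text \<open>Since \<open>v x \<preceq> v y\<close> gives v(zx) \<le> v(zy), \<open>down\<close>
  yields the inclusion of residuals. Conversely, the \<open>z\<close> from \<open>separate\<close>
  lies in the residual of the element of smaller value but not in that of larger value.\<close>

lemma equivalent_v_ofI:
  assumes L: "L \<subseteq> carrier R"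
    and down: "\<And>x y. \<lbrakk>x \<in> carrier R; y \<in> L; v x \<preceq>\<^bsub>M\<^esub> v y\<rbrakk> \<Longrightarrow> x \<in> L"
    and separate: "\<And>x y. \<lbrakk>x \<in> carrier R; y \<in> carrier R; v x \<prec>\<^bsub>M\<^esub> v y\<rbrakk> \<Longrightarrow>
      \<exists>z\<in>carrier R. x \<otimes>\<^bsub>R\<^esub> z \<in> L \<and> y \<otimes>\<^bsub>R\<^esub> z \<notin> L"
  shows "equivalent_valuations R M v (M_of R L) (v_of R L)"
  unfolding equivalent_v_of_iff[OF R.csemiring_axioms]
proof (intro ballI iffI)
  fix x y assume c: "x \<in> carrier R" "y \<in> carrier R"
  show "residual R L y \<subseteq> residual R L x" if "v x \<preceq>\<^bsub>M\<^esub> v y"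
  proof
    fix z assume "z \<in> residual R L y"
    then have "z \<in> carrier R" "z \<otimes>\<^bsub>R\<^esub> y \<in> L" by (simp_all add: residual_def)
    then show "z \<in> residual R L x"
      using down[of "z \<otimes>\<^bsub>R\<^esub> x"] v_mult_left_mono[OF that c, of z] c by (simp add: residual_def)
  qed
  show "v x \<preceq>\<^bsub>M\<^esub> v y" if sub: "residual R L y \<subseteq> residual R L x"
  proof (rule ccontr)
    assume "\<not> v x \<preceq>\<^bsub>M\<^esub> v y"
    then have "v y \<prec>\<^bsub>M\<^esub> v x" using c by (simp add: M.lt_iff_not_leq)
    then obtain z where "z \<in> carrier R" "y \<otimes>\<^bsub>R\<^esub> z \<in> L" "x \<otimes>\<^bsub>R\<^esub> z \<notin> L"
      using separate[of y x] c by blast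
    then show False using sub c by (auto simp: residual_def R.m_comm)
  qed
qed

text \<open>By totality \<open>v y \<preceq> v x\<close> fails, hence so does the corresponding
  inclusion of residuals; \<open>z\<close> is an element violating it.\<close>

lemma equivalent_v_of_separate:
  assumes "equivalent_valuations R M v (M_of R L) (v_of R L)"
    and "x \<in> carrier R" "y \<in> carrier R" "v x \<prec>\<^bsub>M\<^esub> v y"
  shows "\<exists>z\<in>carrier R. x \<otimes>\<^bsub>R\<^esub> z \<in> L \<and> y \<otimes>\<^bsub>R\<^esub> z \<notin> L"
proof -
  have "\<not> residual R L x \<subseteq> residual R L y"
    using assms by (auto simp: equivalent_v_of_iff[OF R.csemiring_axioms] M.lt_iff_not_leq)
  then show ?thesis using assms by (auto simp: residual_def R.m_comm)
qed

section \<open>V0-valuations and V-valuations characterised by strict UIC\<close>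

lemma V0_valuation_iff:
  "V0_valuation R M v \<longleftrightarrow> \<one>\<^bsub>M\<^esub> \<noteq> \<zero>\<^bsub>M\<^esub> \<and> left_strict_UIC R M v"
proof
  assume "V0_valuation R M v"
  then obtain p where p: "semiring_prime R p"
    and eq: "equivalent_valuations R M v (M_of R p) (v_of R p)"
    by (auto simp: V0_valuation_def)
  have leq: "v x \<preceq>\<^bsub>M\<^esub> v y \<longleftrightarrow> residual R p y \<subseteq> residual R p x"
    if "x \<in> carrier R" "y \<in> carrier R" for x y
    using eq that by (simp add: equivalent_v_of_iff[OF R.csemiring_axioms])
  interpret residual_setting R p by unfold_locales (simp add: p)
  have one: "\<one>\<^bsub>R\<^esub> \<notin> p" using p by (simp add: semiring_prime_def)
  have res_one: "residual R p \<one>\<^bsub>R\<^esub> = p" using L_sub by (auto simp: residual_def)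
  \<comment> \<open>This recovers \<open>p\<close> from \<open>v\<close> as {x. v x < 1}. If
    \<open>x\<close> is in \<open>p\<close>, its residual contains the unit, which \<open>p\<close>
    does not; if \<open>x\<close> is outside \<open>p\<close>, closure of the complement under
    products forces every z with zx in \<open>p\<close> into \<open>p\<close>.\<close>
  have one_le: "\<one>\<^bsub>M\<^esub> \<preceq>\<^bsub>M\<^esub> v x \<longleftrightarrow> x \<notin> p" if x: "x \<in> carrier R" for x
  proof -
    have "\<one>\<^bsub>M\<^esub> \<preceq>\<^bsub>M\<^esub> v x \<longleftrightarrow> residual R p x \<subseteq> p"
      using leq[of "\<one>\<^bsub>R\<^esub>" x] x by (simp add: v_one res_one)
    also have "\<dots> \<longleftrightarrow> x \<notin> p"
    proof
      assume "residual R p x \<subseteq> p"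
      moreover have "\<one>\<^bsub>R\<^esub> \<in> residual R p x" if "x \<in> p" using that x by (simp add: residual_def)
      ultimately show "x \<notin> p" using one by blast
    next
      assume "x \<notin> p"
      then show "residual R p x \<subseteq> p"
        using L_compl[OF x] x by (auto simp: residual_def R.m_comm)
    qed
    finally show ?thesis .
  qed
  \<comment> \<open>For a separating z, membership of xz in \<open>p\<close> reads v(xz) < 1 and
    non-membership of yz reads 1 \<le> v(yz).\<close>
  have "left_strict_UIC R M v"
    unfolding left_strict_UIC_def
    using equivalent_v_of_separate[OF eq] one_le by (metis M.lt_iff_not_leq M.one_closed R.m_closed v_carrier)
  moreover have "\<one>\<^bsub>M\<^esub> \<noteq> \<zero>\<^bsub>M\<^esub>"
    using one_le[of "\<zero>\<^bsub>R\<^esub>"] L_zero M.leq_refl[of "\<zero>\<^bsub>M\<^esub>"] by (auto simp: v_zero)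
  ultimately show "\<one>\<^bsub>M\<^esub> \<noteq> \<zero>\<^bsub>M\<^esub> \<and> left_strict_UIC R M v" by simp
next
  assume *: "\<one>\<^bsub>M\<^esub> \<noteq> \<zero>\<^bsub>M\<^esub> \<and> left_strict_UIC R M v"
  define p where "p = {x \<in> carrier R. v x \<prec>\<^bsub>M\<^esub> \<one>\<^bsub>M\<^esub>}"
  \<comment> \<open>By totality the complement of \<open>p\<close> is described by a weak
    inequality, so monotonicity and transitivity suffice there.\<close>
  have in_p: "x \<in> p \<longleftrightarrow> \<not> \<one>\<^bsub>M\<^esub> \<preceq>\<^bsub>M\<^esub> v x" if "x \<in> carrier R" for x
    using that by (simp add: p_def M.lt_iff_not_leq)
  have "semiring_prime R p"
    unfolding semiring_prime_def
  proof (intro conjI)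
    show "p \<subseteq> carrier R" by (auto simp: p_def)
    \<comment> \<open>This is where nontriviality of M enters: it says v(0) < 1.\<close>
    show "\<zero>\<^bsub>R\<^esub> \<in> p" using * by (simp add: p_def v_zero M.zero_lt_iff)
    show "\<one>\<^bsub>R\<^esub> \<notin> p" by (simp add: p_def v_one lt_def)
    show "add_closed R p"
      unfolding add_closed_def
    proof (intro ballI)
      fix x y assume xy: "x \<in> p" "y \<in> p"
      then have c: "x \<in> carrier R" "y \<in> carrier R" by (auto simp: p_def)
      have "\<not> \<one>\<^bsub>M\<^esub> \<preceq>\<^bsub>M\<^esub> omax M (v x) (v y)" using xy c by (simp add: in_p omax_def)
      moreover have "omax M (v x) (v y) \<in> carrier M" using c by (simp add: omax_def)
      ultimately have "\<not> \<one>\<^bsub>M\<^esub> \<preceq>\<^bsub>M\<^esub> v (x \<oplus>\<^bsub>R\<^esub> y)"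
        using v_add[OF c] M.leq_trans[of "\<one>\<^bsub>M\<^esub>" "v (x \<oplus>\<^bsub>R\<^esub> y)" "omax M (v x) (v y)"] c by auto
      then show "x \<oplus>\<^bsub>R\<^esub> y \<in> p" using c by (simp add: in_p)
    qed
    show "mult_closed R p"
      using M.mult_lt_one by (auto simp: mult_closed_def p_def v_mult)
    show "mult_closed R (carrier R - p)"
      using M.mult_mono2[of "\<one>\<^bsub>M\<^esub>" _ "\<one>\<^bsub>M\<^esub>"] by (auto simp: mult_closed_def in_p v_mult)
  qed
  moreover have "equivalent_valuations R M v (M_of R p) (v_of R p)"
  proof (rule equivalent_v_ofI)
    show "p \<subseteq> carrier R" by (auto simp: p_def)
  next
    fix x y assume "x \<in> carrier R" "y \<in> p" "v x \<preceq>\<^bsub>M\<^esub> v y"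
    moreover from this have "y \<in> carrier R" by (simp add: p_def)
    ultimately show "x \<in> p" using M.leq_trans[of "\<one>\<^bsub>M\<^esub>" "v x" "v y"] by (auto simp: in_p)
  next
    fix x y assume c: "x \<in> carrier R" "y \<in> carrier R" and "v x \<prec>\<^bsub>M\<^esub> v y"
    then obtain z where "z \<in> carrier R" "v (x \<otimes>\<^bsub>R\<^esub> z) \<prec>\<^bsub>M\<^esub> \<one>\<^bsub>M\<^esub>" "\<one>\<^bsub>M\<^esub> \<preceq>\<^bsub>M\<^esub> v (y \<otimes>\<^bsub>R\<^esub> z)"
      using * unfolding left_strict_UIC_def by blast
    then show "\<exists>z\<in>carrier R. x \<otimes>\<^bsub>R\<^esub> z \<in> p \<and> y \<otimes>\<^bsub>R\<^esub> z \<notin> p"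
      using c by (intro bexI[of _ z]) (simp_all add: in_p M.lt_iff_not_leq)
  qed
  ultimately show "V0_valuation R M v"
    unfolding V0_valuation_def using m_valuation_axioms by blast
qed

lemma V_valuation_iff:
  "V_valuation R M v \<longleftrightarrow> (\<exists>x\<in>carrier R. \<one>\<^bsub>M\<^esub> \<prec>\<^bsub>M\<^esub> v x) \<and> right_strict_UIC R M v"
proof
  assume "V_valuation R M v"
  then obtain A where A: "proper_CMC_subsemiring R A"
    and eq: "equivalent_valuations R M v (M_of R A) (v_of R A)"
    by (auto simp: V_valuation_def)
  have leq: "v x \<preceq>\<^bsub>M\<^esub> v y \<longleftrightarrow> residual R A y \<subseteq> residual R A x"
    if "x \<in> carrier R" "y \<in> carrier R" for x y
    using eq that by (simp add: equivalent_v_of_iff[OF R.csemiring_axioms])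
  interpret residual_setting R A by unfold_locales (simp add: A)
  have one: "\<one>\<^bsub>R\<^esub> \<in> A" using A by (simp add: proper_CMC_subsemiring_def)
  have res_one: "residual R A \<one>\<^bsub>R\<^esub> = A" using L_sub by (auto simp: residual_def)
  \<comment> \<open>This recovers \<open>A\<close> as {x. v x \<le> 1}. One direction tests the
    inclusion at the unit, which lies in \<open>A\<close>; the other is closure of \<open>A\<close>
    under products.\<close>
  have le_one: "v x \<preceq>\<^bsub>M\<^esub> \<one>\<^bsub>M\<^esub> \<longleftrightarrow> x \<in> A" if x: "x \<in> carrier R" for x
  proof -
    have "v x \<preceq>\<^bsub>M\<^esub> \<one>\<^bsub>M\<^esub> \<longleftrightarrow> A \<subseteq> residual R A x"
      using leq[of x "\<one>\<^bsub>R\<^esub>"] x by (simp add: v_one res_one)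
    also have "\<dots> \<longleftrightarrow> x \<in> A"
    proof
      assume "A \<subseteq> residual R A x"
      then have "\<one>\<^bsub>R\<^esub> \<in> residual R A x" using one by blast
      then show "x \<in> A" using x by (simp add: residual_def)
    next
      assume "x \<in> A"
      then show "A \<subseteq> residual R A x" using L_sub L_mult by (auto simp: residual_def)
    qed
    finally show ?thesis .
  qed
  have "right_strict_UIC R M v"
    unfolding right_strict_UIC_def
    using equivalent_v_of_separate[OF eq] le_one by (metis M.lt_iff_not_leq M.one_closed R.m_closed v_carrier)
  \<comment> \<open>Properness of \<open>A\<close> gives an element outside it, whose value exceeds
    1 by \<open>le_one\<close>.\<close>
  moreover obtain x where "x \<in> carrier R" "x \<notin> A"
    using A L_sub by (auto simp: proper_CMC_subsemiring_def)
  then have "\<exists>x\<in>carrier R. \<one>\<^bsub>M\<^esub> \<prec>\<^bsub>M\<^esub> v x"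
    using le_one[of x] by (auto simp: M.lt_iff_not_leq)
  ultimately show "(\<exists>x\<in>carrier R. \<one>\<^bsub>M\<^esub> \<prec>\<^bsub>M\<^esub> v x) \<and> right_strict_UIC R M v" by simp
next
  assume *: "(\<exists>x\<in>carrier R. \<one>\<^bsub>M\<^esub> \<prec>\<^bsub>M\<^esub> v x) \<and> right_strict_UIC R M v"
  define A where "A = {x \<in> carrier R. v x \<preceq>\<^bsub>M\<^esub> \<one>\<^bsub>M\<^esub>}"
  have "proper_CMC_subsemiring R A"
    unfolding proper_CMC_subsemiring_def
  proof (intro conjI)
    show "A \<subseteq> carrier R" by (auto simp: A_def)
    show "A \<noteq> carrier R" using * by (auto simp: A_def M.lt_iff_not_leq)
    show "\<zero>\<^bsub>R\<^esub> \<in> A" by (simp add: A_def v_zero M.zero_least)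
    show "\<one>\<^bsub>R\<^esub> \<in> A" by (simp add: A_def v_one M.leq_refl)
    show "add_closed R A"
      unfolding add_closed_def
    proof (intro ballI)
      fix x y assume xy: "x \<in> A" "y \<in> A"
      then have c: "x \<in> carrier R" "y \<in> carrier R" by (auto simp: A_def)
      have "omax M (v x) (v y) \<preceq>\<^bsub>M\<^esub> \<one>\<^bsub>M\<^esub>" "omax M (v x) (v y) \<in> carrier M"
        using xy c by (simp_all add: A_def omax_def)
      then show "x \<oplus>\<^bsub>R\<^esub> y \<in> A"
        using v_add[OF c] M.leq_trans[of "v (x \<oplus>\<^bsub>R\<^esub> y)" "omax M (v x) (v y)" "\<one>\<^bsub>M\<^esub>"] c
        by (simp add: A_def)
    qed
    show "mult_closed R A"
      using M.mult_mono2[of _ "\<one>\<^bsub>M\<^esub>" _ "\<one>\<^bsub>M\<^esub>"] by (auto simp: mult_closed_def A_def v_mult)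
    show "mult_closed R (carrier R - A)"
      using M.one_lt_mult by (auto simp: mult_closed_def A_def v_mult M.lt_iff_not_leq)
  qed
  moreover have "equivalent_valuations R M v (M_of R A) (v_of R A)"
  proof (rule equivalent_v_ofI)
    show "A \<subseteq> carrier R" by (auto simp: A_def)
  next
    fix x y assume "x \<in> carrier R" "y \<in> A" "v x \<preceq>\<^bsub>M\<^esub> v y"
    then show "x \<in> A" using M.leq_trans[of "v x" "v y" "\<one>\<^bsub>M\<^esub>"] by (auto simp: A_def)
  next
    fix x y assume c: "x \<in> carrier R" "y \<in> carrier R" and "v x \<prec>\<^bsub>M\<^esub> v y"
    then obtain z where "z \<in> carrier R" "v (x \<otimes>\<^bsub>R\<^esub> z) \<preceq>\<^bsub>M\<^esub> \<one>\<^bsub>M\<^esub>" "\<one>\<^bsub>M\<^esub> \<prec>\<^bsub>M\<^esub> v (y \<otimes>\<^bsub>R\<^esub> z)"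
      using * unfolding right_strict_UIC_def by blast
    then show "\<exists>z\<in>carrier R. x \<otimes>\<^bsub>R\<^esub> z \<in> A \<and> y \<otimes>\<^bsub>R\<^esub> z \<notin> A"
      using c by (intro bexI[of _ z]) (simp_all add: A_def M.lt_iff_not_leq)
  qed
  ultimately show "V_valuation R M v"
    unfolding V_valuation_def using m_valuation_axioms by blast
qed

text \<open>A V-valuation takes a value above 1, whereas if 1 = 0 every value equals 1 times itself,
  hence 0 = 1.\<close>

lemma V0_or_V_nontrivial:
  assumes "V0_valuation R M v \<or> V_valuation R M v"
  shows "\<one>\<^bsub>M\<^esub> \<noteq> \<zero>\<^bsub>M\<^esub>"
proof
  assume 10: "\<one>\<^bsub>M\<^esub> = \<zero>\<^bsub>M\<^esub>"
  then obtain x where x: "x \<in> carrier R" "\<one>\<^bsub>M\<^esub> \<prec>\<^bsub>M\<^esub> v x"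
    using assms by (auto simp: V0_valuation_iff V_valuation_iff)
  have "v x = \<one>\<^bsub>M\<^esub> \<otimes>\<^bsub>M\<^esub> v x" using x by simp
  also have "\<dots> = \<one>\<^bsub>M\<^esub>" unfolding 10 using x by simp
  finally show False using x by (simp add: lt_def)
qed

section \<open>Strict UIC over a cancellative value semiring\<close>

lemma UIC_cancellative_strict:
  assumes UIC: "UIC R M v" and nontrivial: "\<one>\<^bsub>M\<^esub> \<noteq> \<zero>\<^bsub>M\<^esub>"
    and cancel: "\<And>a b c. \<lbrakk>a \<in> carrier M; b \<in> carrier M; c \<in> carrier M; c \<noteq> \<zero>\<^bsub>M\<^esub>;
      a \<otimes>\<^bsub>M\<^esub> c = b \<otimes>\<^bsub>M\<^esub> c\<rbrakk> \<Longrightarrow> a = b"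
  shows "left_strict_UIC R M v \<or> right_strict_UIC R M v"
proof (rule ccontr)
  assume "\<not> ?thesis"
  then obtain x y x' y' where c: "x \<in> carrier R" "y \<in> carrier R" "x' \<in> carrier R" "y' \<in> carrier R"
    and lt: "v x \<prec>\<^bsub>M\<^esub> v y" "v x' \<prec>\<^bsub>M\<^esub> v y'"
    and no_left: "\<And>z. z \<in> carrier R \<Longrightarrow> \<not> (v (x \<otimes>\<^bsub>R\<^esub> z) \<prec>\<^bsub>M\<^esub> \<one>\<^bsub>M\<^esub> \<and> \<one>\<^bsub>M\<^esub> \<preceq>\<^bsub>M\<^esub> v (y \<otimes>\<^bsub>R\<^esub> z))"
    and no_right: "\<And>z. z \<in> carrier R \<Longrightarrow> \<not> (v (x' \<otimes>\<^bsub>R\<^esub> z) \<preceq>\<^bsub>M\<^esub> \<one>\<^bsub>M\<^esub> \<and> \<one>\<^bsub>M\<^esub> \<prec>\<^bsub>M\<^esub> v (y' \<otimes>\<^bsub>R\<^esub> z))"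
    unfolding left_strict_UIC_def right_strict_UIC_def by blast
  \<comment> \<open>This is the only use of cancellation: v(z) is nonzero because v(az) = 1, so
    v(az) = v(bz) would give v(a) = v(b).\<close>
  have not_both_one: "\<not> (v (a \<otimes>\<^bsub>R\<^esub> z) = \<one>\<^bsub>M\<^esub> \<and> v (b \<otimes>\<^bsub>R\<^esub> z) = \<one>\<^bsub>M\<^esub>)"
    if abz: "a \<in> carrier R" "b \<in> carrier R" "z \<in> carrier R" "v a \<prec>\<^bsub>M\<^esub> v b" for a b z
  proof
    assume one: "v (a \<otimes>\<^bsub>R\<^esub> z) = \<one>\<^bsub>M\<^esub> \<and> v (b \<otimes>\<^bsub>R\<^esub> z) = \<one>\<^bsub>M\<^esub>"
    have "v z \<noteq> \<zero>\<^bsub>M\<^esub>"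
    proof
      assume "v z = \<zero>\<^bsub>M\<^esub>"
      then show False using one nontrivial abz by (simp add: v_mult)
    qed
    then have "v a = v b" using cancel[of "v a" "v b" "v z"] one abz by (simp add: v_mult)
    then show False using abz by (simp add: lt_def)
  qed
  \<comment> \<open>UIC for the pair that violates the left-strict form must be attained with
    equality on the left; \<open>not_both_one\<close> then makes the right side strict. The pair
    \<open>x'\<close>, \<open>y'\<close> is treated dually.\<close>
  obtain z where z: "z \<in> carrier R" "v (x \<otimes>\<^bsub>R\<^esub> z) \<preceq>\<^bsub>M\<^esub> \<one>\<^bsub>M\<^esub>" "\<one>\<^bsub>M\<^esub> \<preceq>\<^bsub>M\<^esub> v (y \<otimes>\<^bsub>R\<^esub> z)"
    using UIC c lt unfolding UIC_def by blast
  then have xz: "v (x \<otimes>\<^bsub>R\<^esub> z) = \<one>\<^bsub>M\<^esub>" using no_left by (auto simp: lt_def)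
  then have yz: "\<one>\<^bsub>M\<^esub> \<prec>\<^bsub>M\<^esub> v (y \<otimes>\<^bsub>R\<^esub> z)" using z c lt not_both_one[of x y z] by (auto simp: lt_def)
  obtain z' where z': "z' \<in> carrier R" "v (x' \<otimes>\<^bsub>R\<^esub> z') \<preceq>\<^bsub>M\<^esub> \<one>\<^bsub>M\<^esub>" "\<one>\<^bsub>M\<^esub> \<preceq>\<^bsub>M\<^esub> v (y' \<otimes>\<^bsub>R\<^esub> z')"
    using UIC c lt unfolding UIC_def by blast
  then have y'z': "v (y' \<otimes>\<^bsub>R\<^esub> z') = \<one>\<^bsub>M\<^esub>" using no_right by (metis lt_def)
  then have x'z': "v (x' \<otimes>\<^bsub>R\<^esub> z') \<prec>\<^bsub>M\<^esub> \<one>\<^bsub>M\<^esub>" using z' c lt not_both_one[of x' y' z'] by (auto simp: lt_def)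
  \<comment> \<open>These have values above and below 1, and each serves as a further multiplier for
    the pair it does not come from.\<close>
  define u t where "u = y \<otimes>\<^bsub>R\<^esub> z" and "t = x' \<otimes>\<^bsub>R\<^esub> z'"
  have ut: "u \<in> carrier R" "t \<in> carrier R" using c z z' by (simp_all add: u_def t_def)
  show False
  proof (cases "\<one>\<^bsub>M\<^esub> \<preceq>\<^bsub>M\<^esub> v (u \<otimes>\<^bsub>R\<^esub> t)")
    case True
    \<comment> \<open>As v(xz) = 1, the multiplier zt gives v(xzt) = v(t) < 1 \<le> v(ut) = v(yzt),
      against \<open>no_left\<close>.\<close>
    have "v (x \<otimes>\<^bsub>R\<^esub> (z \<otimes>\<^bsub>R\<^esub> t)) = v (x \<otimes>\<^bsub>R\<^esub> z) \<otimes>\<^bsub>M\<^esub> v t"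
      using c z ut by (simp add: R.m_assoc[symmetric] v_mult)
    then have "v (x \<otimes>\<^bsub>R\<^esub> (z \<otimes>\<^bsub>R\<^esub> t)) = v t" using ut by (simp add: xz)
    moreover have "y \<otimes>\<^bsub>R\<^esub> (z \<otimes>\<^bsub>R\<^esub> t) = u \<otimes>\<^bsub>R\<^esub> t" using c z ut by (simp add: u_def R.m_assoc)
    ultimately show False using no_left[of "z \<otimes>\<^bsub>R\<^esub> t"] True x'z' z ut by (simp add: t_def)
  next
    case False
    \<comment> \<open>As v(y'z') = 1, the multiplier z'u gives v(x'z'u) = v(ut) \<le> 1 < v(u) =
      v(y'z'u), against \<open>no_right\<close>.\<close>
    then have "v (u \<otimes>\<^bsub>R\<^esub> t) \<preceq>\<^bsub>M\<^esub> \<one>\<^bsub>M\<^esub>" using ut M.leq_total[of "\<one>\<^bsub>M\<^esub>" "v (u \<otimes>\<^bsub>R\<^esub> t)"] by simp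
    moreover have "x' \<otimes>\<^bsub>R\<^esub> (z' \<otimes>\<^bsub>R\<^esub> u) = u \<otimes>\<^bsub>R\<^esub> t" using c z' ut by (simp add: t_def R.m_ac)
    moreover have "v (y' \<otimes>\<^bsub>R\<^esub> (z' \<otimes>\<^bsub>R\<^esub> u)) = v (y' \<otimes>\<^bsub>R\<^esub> z') \<otimes>\<^bsub>M\<^esub> v u"
      using c z' ut by (simp add: R.m_assoc[symmetric] v_mult)
    then have "v (y' \<otimes>\<^bsub>R\<^esub> (z' \<otimes>\<^bsub>R\<^esub> u)) = v u" using ut by (simp add: y'z')
    ultimately show False using no_right[of "z' \<otimes>\<^bsub>R\<^esub> u"] yz z' ut by (simp add: u_def)
  qed
qed

section \<open>Passage to the quotient M/C\<close>

lemma quotient_C_UIC: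
  assumes "UIC R M v"
  shows "UIC R (quotient_semiring M (min_cancel_rel M)) (quotient_map (min_cancel_rel M) \<circ> v)"
    (is "UIC R ?Q ?w")
proof -
  interpret W: m_valuation R ?Q ?w by (rule quotient_C_m_valuation) (rule m_valuation_axioms)
  have leq: "?w x \<preceq>\<^bsub>?Q\<^esub> ?w y" if "v x \<preceq>\<^bsub>M\<^esub> v y" "x \<in> carrier R" "y \<in> carrier R" for x y
    using that by (simp add: quotient_map_def M.C_leq_class M.C_leq_def)
  show ?thesis
    unfolding UIC_def
  proof (intro ballI impI)
    fix x y assume c: "x \<in> carrier R" "y \<in> carrier R" and "?w x \<prec>\<^bsub>?Q\<^esub> ?w y"
    \<comment> \<open>A strict inequality in the quotient lifts to M, since \<open>leq\<close> would
      carry the reverse weak inequality down. The \<open>z\<close> found for \<open>v\<close> then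
      also serves in the quotient.\<close>
    then have "\<not> v y \<preceq>\<^bsub>M\<^esub> v x" using leq[of y x] W.M.lt_iff_not_leq[of "?w x" "?w y"] W.v_carrier by blast
    then have "v x \<prec>\<^bsub>M\<^esub> v y" using c by (simp add: M.lt_iff_not_leq)
    then obtain z where z: "z \<in> carrier R" "v (x \<otimes>\<^bsub>R\<^esub> z) \<preceq>\<^bsub>M\<^esub> \<one>\<^bsub>M\<^esub>" "\<one>\<^bsub>M\<^esub> \<preceq>\<^bsub>M\<^esub> v (y \<otimes>\<^bsub>R\<^esub> z)"
      using assms c unfolding UIC_def by blast
    then show "\<exists>z\<in>carrier R. ?w (x \<otimes>\<^bsub>R\<^esub> z) \<preceq>\<^bsub>?Q\<^esub> \<one>\<^bsub>?Q\<^esub> \<and> \<one>\<^bsub>?Q\<^esub> \<preceq>\<^bsub>?Q\<^esub> ?w (y \<otimes>\<^bsub>R\<^esub> z)"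
      using leq[of "x \<otimes>\<^bsub>R\<^esub> z" "\<one>\<^bsub>R\<^esub>"] leq[of "\<one>\<^bsub>R\<^esub>" "y \<otimes>\<^bsub>R\<^esub> z"] c W.v_one v_one
      by (intro bexI[of _ z]) simp_all
  qed
qed

end

theorem mainTheorem3:
  fixes R :: "('r, 'a) ring_scheme" and M :: "('m, 'b) osemiring_scheme" and v :: "'r \<Rightarrow> 'm"
  assumes "csemiring R" and "bipotent_semiring M"
    and "v ` carrier R = carrier M"
    and "V0_valuation R M v \<or> V_valuation R M v"
  shows "let C = min_cancel_rel M;
             Mbar = quotient_semiring M C;
             vbar = quotient_map C \<circ> v
         in UIC R M v \<and> UIC R Mbar vbar \<and>
            ({x \<in> carrier Mbar. x \<prec>\<^bsub>Mbar\<^esub> \<one>\<^bsub>Mbar\<^esub>} \<noteq> {\<zero>\<^bsub>Mbar\<^esub>} \<longrightarrow>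
               V0_valuation R Mbar vbar \<or> V_valuation R Mbar vbar)"
proof -
  interpret csemiring R by (rule assms)
  interpret m_valuation R M v using assms(4) by (auto simp: V0_valuation_def V_valuation_def)
  define Q where "Q = quotient_semiring M (min_cancel_rel M)"
  define w where "w = quotient_map (min_cancel_rel M) \<circ> v"
  interpret W: m_valuation R Q w
    unfolding Q_def w_def by (rule quotient_C_m_valuation) (rule m_valuation_axioms)
  have UIC: "UIC R M v"
    using assms(4) left_strict_UIC_imp_UIC right_strict_UIC_imp_UIC
    by (auto simp: V0_valuation_iff V_valuation_iff)
  then have UIC_w: "UIC R Q w" unfolding Q_def w_def by (rule quotient_C_UIC)
  have nontrivial: "\<one>\<^bsub>Q\<^esub> \<noteq> \<zero>\<^bsub>Q\<^esub>"
    using V0_or_V_nontrivial[OF assms(4)] unfolding Q_def by (simp add: M.quotient_C_one_eq_zero_iff)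
  have "V0_valuation R Q w \<or> V_valuation R Q w"
  proof (cases "left_strict_UIC R Q w")
    case True
    then show ?thesis using nontrivial by (simp add: W.V0_valuation_iff)
  next
    case False
    have "left_strict_UIC R Q w \<or> right_strict_UIC R Q w"
      by (rule W.UIC_cancellative_strict[OF UIC_w nontrivial]) (use M.quotient_C_cancel Q_def in blast)
    with False have right: "right_strict_UIC R Q w" by blast
    \<comment> \<open>A V-valuation needs a value above 1; right-strict UIC applied to the pair 0, 1
      produces one.\<close>
    have "\<zero>\<^bsub>Q\<^esub> \<prec>\<^bsub>Q\<^esub> \<one>\<^bsub>Q\<^esub>" using nontrivial by (simp add: W.M.zero_lt_iff)
    then have "w \<zero>\<^bsub>R\<^esub> \<prec>\<^bsub>Q\<^esub> w \<one>\<^bsub>R\<^esub>" by (simp add: W.v_zero W.v_one)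
    then obtain z where "z \<in> carrier R" "\<one>\<^bsub>Q\<^esub> \<prec>\<^bsub>Q\<^esub> w (\<one>\<^bsub>R\<^esub> \<otimes>\<^bsub>R\<^esub> z)"
      using right zero_closed one_closed unfolding right_strict_UIC_def by blast
    then have "\<exists>y\<in>carrier R. \<one>\<^bsub>Q\<^esub> \<prec>\<^bsub>Q\<^esub> w y" by auto
    then show ?thesis using right by (simp add: W.V_valuation_iff)
  qed
  then show ?thesis using UIC UIC_w by (simp add: Let_def Q_def w_def)
qed

end
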